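(* Let $m,n\ge 2$ and let $G(m,n)=P_m\times P_n$ be the $m\times n$ grid graph (Cartesian product of the paths on $m$ and $n$ vertices). Then the $(mn-3)$-dimensional total $2$-cut complex $\Delta_2^t(G(m,n))$ is homotopy equivalent to a wedge of $(m-1)(n-1)$ spheres of dimension $mn-4$.
   Context: For a graph $G$, the total $2$-cut complex $\Delta_2^t(G)$ is the simplicial complex on $V(G)$ whose facets are the sets $V(G)\setminus\{a,b\}$ where $a\ne b$ and $ab$ is not an edge of $G$. *)

theory Defs
  imports "HOL-Analysis.Analysis"
begin

section \<open>Finite simple graphs\<close>

record 'a ugraph =
  verts :: "'a set"
  edges :: "'a set set"

definition path_graph :: "nat \<Rightarrow> nat ugraph" where
  "path_graph n = \<lparr>verts = {..<n}, edges = {{i, Suc i} | i. Suc i < n}\<rparr>"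

definition cartesian_product :: "'a ugraph \<Rightarrow> 'b ugraph \<Rightarrow> ('a \<times> 'b) ugraph" where
  "cartesian_product G H =
     \<lparr>verts = verts G \<times> verts H,
      edges = {{(u, w), (u', w)} | u u' w. {u, u'} \<in> edges G \<and> w \<in> verts H}
            \<union> {{(u, w), (u, w')} | u w w'. u \<in> verts G \<and> {w, w'} \<in> edges H}\<rparr>"

definition grid_graph :: "nat \<Rightarrow> nat \<Rightarrow> (nat \<times> nat) ugraph" where
  "grid_graph m n = cartesian_product (path_graph m) (path_graph n)"


section \<open>Abstract simplicial complexes\<close>

text \<open>A complex is given by its set of faces, the empty face included. (The constant
  \<^const>\<open>simplicial_complex\<close> of the library is about geometric complexes.)\<close>

definition complex_generated_by :: "'a set set \<Rightarrow> 'a set set" where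
  "complex_generated_by F = {\<sigma>. \<exists>\<tau>\<in>F. \<sigma> \<subseteq> \<tau>}"

definition facets :: "'a set set \<Rightarrow> 'a set set" where
  "facets K = {\<sigma> \<in> K. \<forall>\<tau>\<in>K. \<sigma> \<subseteq> \<tau> \<longrightarrow> \<sigma> = \<tau>}"

definition complex_dim :: "'a set set \<Rightarrow> int" where
  "complex_dim K = int (Max (card ` K)) - 1"

text \<open>Points of the geometric realization are given by their barycentric coordinates. The
  product topology used here is the usual (weak) topology because only finite complexes are
  considered. The empty face contributes no point.\<close>

definition geometric_realization :: "'a set set \<Rightarrow> ('a \<Rightarrow> real) topology" where
  "geometric_realization K =
     subtopology (powertop_real UNIV)
       {x. (\<forall>v. 0 \<le> x v) \<and> {v. x v \<noteq> 0} \<in> K \<and> (\<Sum>v | x v \<noteq> 0. x v) = 1}"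

definition total_2_cut_complex :: "'a ugraph \<Rightarrow> 'a set set" where
  "total_2_cut_complex G =
     complex_generated_by
       {verts G - {a, b} | a b. a \<in> verts G \<and> b \<in> verts G \<and> a \<noteq> b \<and> {a, b} \<notin> edges G}"

lemma facets_total_2_cut_complex:
  assumes fin: "finite (verts G)"
  shows "facets (total_2_cut_complex G) =
     {verts G - {a, b} | a b. a \<in> verts G \<and> b \<in> verts G \<and> a \<noteq> b \<and> {a, b} \<notin> edges G}"
    (is "_ = ?F")
proof -
  have max: "\<sigma> = \<rho>" if "\<sigma> \<in> F" "\<tau> \<in> F" "\<sigma> \<subseteq> \<rho>" "\<rho> \<subseteq> \<tau>"
      and F: "\<And>\<tau>. \<tau> \<in> F \<Longrightarrow> finite \<tau> \<and> card \<tau> = k" for \<sigma> \<rho> \<tau> :: "'a set" and F k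
  proof -
    have "\<sigma> = \<tau>"
      using that(3,4) F[OF that(1)] F[OF that(2)] by (intro card_subset_eq) auto
    with that(3,4) show ?thesis by blast
  qed
  have gen: "facets (complex_generated_by F) = F"
    if F: "\<And>\<tau>. \<tau> \<in> F \<Longrightarrow> finite \<tau> \<and> card \<tau> = k" for F :: "'a set set" and k
  proof (rule set_eqI)
    fix \<sigma>
    show "\<sigma> \<in> facets (complex_generated_by F) \<longleftrightarrow> \<sigma> \<in> F"
    proof
      assume *: "\<sigma> \<in> facets (complex_generated_by F)"
      then obtain \<tau> where \<tau>: "\<tau> \<in> F" "\<sigma> \<subseteq> \<tau>"
        unfolding facets_def complex_generated_by_def by blast
      then have "\<tau> \<in> complex_generated_by F"
        unfolding complex_generated_by_def by blast
      with * \<tau> have "\<sigma> = \<tau>"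
        unfolding facets_def by blast
      with \<tau> show "\<sigma> \<in> F" by simp
    next
      assume \<sigma>: "\<sigma> \<in> F"
      show "\<sigma> \<in> facets (complex_generated_by F)"
        unfolding facets_def complex_generated_by_def
        using \<sigma> max[OF \<sigma> _ _ _ F] by blast
    qed
  qed
  have "finite \<tau> \<and> card \<tau> = card (verts G) - 2" if "\<tau> \<in> ?F" for \<tau>
  proof -
    from that obtain a b where "\<tau> = verts G - {a, b}" "{a, b} \<subseteq> verts G" "a \<noteq> b"
      by blast
    with fin show ?thesis
      by (simp add: card_Diff_subset)
  qed
  then show ?thesis
    unfolding total_2_cut_complex_def by (rule gen)
qed


section \<open>Wedges of pointed spaces\<close>

text \<open>The wedge is the quotient of the disjoint union in which all base points are identified;
  \<^const>\<open>None\<close> is the common base point. For the empty family this is a one-point space.\<close>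

definition wedge_proj :: "('i \<Rightarrow> 'a) \<Rightarrow> 'i \<times> 'a \<Rightarrow> ('i \<times> 'a) option" where
  "wedge_proj p z = (if snd z = p (fst z) then None else Some z)"

definition wedge :: "('i \<Rightarrow> 'a topology) \<Rightarrow> ('i \<Rightarrow> 'a) \<Rightarrow> 'i set \<Rightarrow> ('i \<times> 'a) option topology" where
  "wedge X p I =
     topology (\<lambda>U. U \<subseteq> insert None (wedge_proj p ` topspace (sum_topology X I)) \<and>
       openin (sum_topology X I) {z \<in> topspace (sum_topology X I). wedge_proj p z \<in> U})"

lemma openin_wedge:
  "openin (wedge X p I) U \<longleftrightarrow>
     U \<subseteq> insert None (wedge_proj p ` topspace (sum_topology X I)) \<and>
     openin (sum_topology X I) {z \<in> topspace (sum_topology X I). wedge_proj p z \<in> U}"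
proof -
  let ?S = "sum_topology X I"
  let ?pre = "\<lambda>U. {z \<in> topspace ?S. wedge_proj p z \<in> U}"
  have "istopology (\<lambda>U. U \<subseteq> insert None (wedge_proj p ` topspace ?S) \<and> openin ?S (?pre U))"
    unfolding istopology_def
  proof (intro conjI allI impI)
    fix A B
    assume "A \<subseteq> insert None (wedge_proj p ` topspace ?S) \<and> openin ?S (?pre A)"
      and "B \<subseteq> insert None (wedge_proj p ` topspace ?S) \<and> openin ?S (?pre B)"
    moreover have "?pre (A \<inter> B) = ?pre A \<inter> ?pre B" by blast
    ultimately show "A \<inter> B \<subseteq> insert None (wedge_proj p ` topspace ?S)"
      and "openin ?S (?pre (A \<inter> B))" by auto
  next
    fix \<K>
    assume *: "\<forall>K\<in>\<K>. K \<subseteq> insert None (wedge_proj p ` topspace ?S) \<and> openin ?S (?pre K)"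
    have "?pre (\<Union>\<K>) = (\<Union>K\<in>\<K>. ?pre K)" by blast
    with * show "openin ?S (?pre (\<Union>\<K>))" by auto
    from * show "\<Union>\<K> \<subseteq> insert None (wedge_proj p ` topspace ?S)" by blast
  qed
  then show ?thesis
    by (simp add: wedge_def)
qed

lemma topspace_wedge:
  "topspace (wedge X p I) = insert None (wedge_proj p ` topspace (sum_topology X I))"
proof -
  let ?T = "insert None (wedge_proj p ` topspace (sum_topology X I))"
  have "{z \<in> topspace (sum_topology X I). wedge_proj p z \<in> ?T} = topspace (sum_topology X I)"
    by blast
  then have "openin (wedge X p I) ?T"
    unfolding openin_wedge by (metis openin_topspace order_refl)
  then show ?thesis
    using openin_subset[of "wedge X p I" ?T] openin_topspace[of "wedge X p I"]
    unfolding openin_wedge by blast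
qed

lemma quotient_map_wedge_proj:
  assumes "I \<noteq> {}" and p: "\<And>i. i \<in> I \<Longrightarrow> p i \<in> topspace (X i)"
  shows "quotient_map (sum_topology X I) (wedge X p I) (wedge_proj p)"
proof -
  from assms obtain i where "i \<in> I" "p i \<in> topspace (X i)" by blast
  then have "None \<in> wedge_proj p ` topspace (sum_topology X I)"
    by (intro image_eqI[where x = "(i, p i)"]) (auto simp: wedge_proj_def)
  then have "insert None (wedge_proj p ` topspace (sum_topology X I)) =
      wedge_proj p ` topspace (sum_topology X I)"
    by (rule insert_absorb)
  then show ?thesis
    by (simp add: quotient_map_def topspace_wedge openin_wedge)
qed

definition wedge_of_spheres :: "nat \<Rightarrow> nat \<Rightarrow> (nat \<times> (nat \<Rightarrow> real)) option topology" where
  "wedge_of_spheres k d =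
     wedge (\<lambda>_. nsphere d) (\<lambda>_ i. if i = 0 then 1 else 0) {..<k}"

end

theory Submission
  imports Defs "HOL-Library.Ramsey"
begin

text \<open>A set of vertices is a face of the total 2-cut complex iff its complement is not a clique.
  Let \<open>G\<close> be connected and triangle-free, and fix a vertex \<open>p\<close> and a spanning tree containing all
  edges at \<open>p\<close>. The closed star of \<open>p\<close> is a cone; the other faces are the complements of \<open>{p, v}\<close>
  with \<open>v\<close> not adjacent to \<open>p\<close>, and of \<open>{p} \<union> e\<close> with \<open>e\<close> an edge avoiding \<open>p\<close>. Matching \<open>v\<close> with
  the tree edge from \<open>v\<close> towards \<open>p\<close> and collapsing these pairs, nearest to the root first, leaves
  the cone together with one simplex with \<open>|V| - 3\<close> vertices, attached along its boundary, for each
  of the \<open>|E| - |V| + 1\<close> edges outside the tree. Shrinking the cone to a point turns this into a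
  wedge of spheres. Grids are connected and triangle-free, being products of paths.\<close>

section \<open>Wedges\<close>

lemma continuous_map_wedge_inclusion:
  assumes "i \<in> I"
  shows "continuous_map (X i) (wedge X p I) (\<lambda>x. wedge_proj p (i, x))"
  unfolding continuous_map_def
proof (intro conjI allI impI)
  show "(\<lambda>x. wedge_proj p (i, x)) \<in> topspace (X i) \<rightarrow> topspace (wedge X p I)"
    using assms by (auto simp: topspace_wedge)
  fix U assume "openin (wedge X p I) U"
  then have "openin (X i) {x. (i, x) \<in> {z \<in> topspace (sum_topology X I). wedge_proj p z \<in> U}}"
    using assms unfolding openin_wedge openin_sum_topology by blast
  with assms show "openin (X i) {x \<in> topspace (X i). wedge_proj p (i, x) \<in> U}"
    by simp
qed

lemma continuous_map_from_wedge:
  assumes base: "f None \<in> topspace Y"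
    and cont: "\<And>i. i \<in> I \<Longrightarrow> continuous_map (X i) Y (\<lambda>x. f (wedge_proj p (i, x)))"
  shows "continuous_map (wedge X p I) Y f"
  unfolding continuous_map_def
proof (intro conjI allI impI)
  show "f \<in> topspace (wedge X p I) \<rightarrow> topspace Y"
    using base continuous_map_funspace[OF cont] by (auto simp: topspace_wedge Pi_iff)
  fix U assume "openin Y U"
  then have "openin (X i) {x \<in> topspace (X i). f (wedge_proj p (i, x)) \<in> U}" if "i \<in> I" for i
    using cont[OF that] by (simp add: continuous_map_def)
  moreover have "{z \<in> topspace (sum_topology X I).
        wedge_proj p z \<in> {w \<in> topspace (wedge X p I). f w \<in> U}}
      = (SIGMA i:I. {x \<in> topspace (X i). f (wedge_proj p (i, x)) \<in> U})"
    unfolding topspace_wedge by auto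
  ultimately show "openin (wedge X p I) {w \<in> topspace (wedge X p I). f w \<in> U}"
    unfolding openin_wedge topspace_wedge[symmetric]
    by (simp add: openin_disjoint_union Collect_restrict del: topspace_sum_topology)
qed

lemma Some_in_topspace_wedge_iff:
  "Some (i, x) \<in> topspace (wedge X p I) \<longleftrightarrow> i \<in> I \<and> x \<in> topspace (X i) \<and> x \<noteq> p i"
  by (auto simp: topspace_wedge wedge_proj_def split: if_splits)

definition wedge_coordinates :: "('i \<Rightarrow> 'a) \<Rightarrow> 'i set \<Rightarrow> ('i \<times> 'a) option \<Rightarrow> 'i \<Rightarrow> 'a" where
  "wedge_coordinates p I w =
     (\<lambda>j\<in>I. case w of None \<Rightarrow> p j | Some (i, x) \<Rightarrow> if i = j then x else p j)"

lemma continuous_map_wedge_coordinates: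
  assumes p: "\<And>i. i \<in> I \<Longrightarrow> p i \<in> topspace (X i)"
  shows "continuous_map (wedge X p I) (product_topology X I) (wedge_coordinates p I)"
proof (rule continuous_map_from_wedge)
  show "wedge_coordinates p I None \<in> topspace (product_topology X I)"
    using p by (auto simp: wedge_coordinates_def)
  fix i assume "i \<in> I"
  have axis: "wedge_coordinates p I (wedge_proj p (i, x)) = (\<lambda>j\<in>I. if i = j then x else p j)" for x
    by (auto simp: wedge_coordinates_def wedge_proj_def)
  show "continuous_map (X i) (product_topology X I) (\<lambda>x. wedge_coordinates p I (wedge_proj p (i, x)))"
    unfolding axis continuous_map_componentwise
  proof (intro conjI ballI)
    fix j assume "j \<in> I"
    with p show "continuous_map (X i) (X j) (\<lambda>x. (\<lambda>j\<in>I. if i = j then x else p j) j)"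
      by (cases "i = j") auto
  qed auto
qed

lemma inj_on_wedge_coordinates: "inj_on (wedge_coordinates p I) (topspace (wedge X p I))"
proof (rule inj_onI)
  fix w w' assume w: "w \<in> topspace (wedge X p I)" "w' \<in> topspace (wedge X p I)"
    and eq: "wedge_coordinates p I w = wedge_coordinates p I w'"
  have coordinate: "wedge_coordinates p I u j =
      (case u of None \<Rightarrow> p j | Some (i, x) \<Rightarrow> if i = j then x else p j)"
    if "j \<in> I" for u j
    using that by (simp add: wedge_coordinates_def)
  have "w' = Some (i, x)" if "Some (i, x) \<in> topspace (wedge X p I)" "w' \<in> topspace (wedge X p I)"
    "wedge_coordinates p I (Some (i, x)) = wedge_coordinates p I w'" for i x w'
    using fun_cong[OF that(3), of i] that(1,2)
    by (cases w') (auto simp: coordinate Some_in_topspace_wedge_iff split: if_splits)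
  with w eq show "w = w'"
    by (metis not_None_eq surj_pair)
qed

lemma Hausdorff_space_wedge:
  assumes "\<And>i. i \<in> I \<Longrightarrow> Hausdorff_space (X i)" and "\<And>i. i \<in> I \<Longrightarrow> p i \<in> topspace (X i)"
  shows "Hausdorff_space (wedge X p I)"
proof (rule Hausdorff_space_injective_preimage)
  show "Hausdorff_space (product_topology X I)"
    using assms(1) by (simp add: Hausdorff_space_product_topology)
  show "continuous_map (wedge X p I) (product_topology X I) (wedge_coordinates p I)"
    by (rule continuous_map_wedge_coordinates[OF assms(2)])
  show "inj_on (wedge_coordinates p I) (topspace (wedge X p I))"
    by (rule inj_on_wedge_coordinates)
qed

definition wedge_reindex :: "('i \<Rightarrow> 'j) \<Rightarrow> ('i \<times> 'a) option \<Rightarrow> ('j \<times> 'a) option" where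
  "wedge_reindex f = map_option (map_prod f id)"

lemma wedge_reindex_compose: "wedge_reindex g (wedge_reindex f w) = wedge_reindex (g \<circ> f) w"
  by (simp add: wedge_reindex_def option.map_comp map_prod_compose[symmetric])

lemma continuous_map_wedge_reindex:
  assumes "f \<in> I \<rightarrow> J" and "\<And>i. i \<in> I \<Longrightarrow> Y (f i) = X i" and "\<And>i. i \<in> I \<Longrightarrow> q (f i) = p i"
  shows "continuous_map (wedge X p I) (wedge Y q J) (wedge_reindex f)"
proof (rule continuous_map_from_wedge)
  show "wedge_reindex f None \<in> topspace (wedge Y q J)"
    by (simp add: wedge_reindex_def topspace_wedge)
  fix i assume i: "i \<in> I"
  with assms(3) have "wedge_reindex f (wedge_proj p (i, x)) = wedge_proj q (f i, x)" for x
    by (simp add: wedge_reindex_def wedge_proj_def)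
  moreover have "continuous_map (X i) (wedge Y q J) (\<lambda>x. wedge_proj q (f i, x))"
    using continuous_map_wedge_inclusion[of "f i" J Y q] assms(1,2) i by (auto simp: Pi_iff)
  ultimately show "continuous_map (X i) (wedge Y q J) (\<lambda>x. wedge_reindex f (wedge_proj p (i, x)))"
    by simp
qed

lemma homeomorphic_space_wedge_reindex:
  assumes f: "bij_betw f I J"
    and "\<And>i. i \<in> I \<Longrightarrow> Y (f i) = X i" and "\<And>i. i \<in> I \<Longrightarrow> q (f i) = p i"
  shows "wedge X p I homeomorphic_space wedge Y q J"
proof -
  let ?g = "inv_into I f"
  have g: "?g j \<in> I" "f (?g j) = j" if "j \<in> J" for j
    using f that by (auto simp: bij_betw_def inv_into_into f_inv_into_f)
  have gf: "?g (f i) = i" if "i \<in> I" for i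
    using f that by (simp add: bij_betw_def)
  have inverse: "wedge_reindex h w = w"
    if "w \<in> topspace (wedge Z r K)" "\<And>i. i \<in> K \<Longrightarrow> h i = i" for w h and Z :: "'k \<Rightarrow> 'c topology" and r K
    using that by (cases w) (auto simp: wedge_reindex_def Some_in_topspace_wedge_iff)
  have "homeomorphic_maps (wedge X p I) (wedge Y q J) (wedge_reindex f) (wedge_reindex ?g)"
    unfolding homeomorphic_maps_def
  proof (intro conjI ballI)
    show "continuous_map (wedge X p I) (wedge Y q J) (wedge_reindex f)"
      using assms by (intro continuous_map_wedge_reindex) (auto simp: bij_betw_def)
    show "continuous_map (wedge Y q J) (wedge X p I) (wedge_reindex ?g)"
      using assms(2,3)[OF g(1)] g by (intro continuous_map_wedge_reindex) auto
  qed (auto simp: wedge_reindex_compose g gf intro!: inverse)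
  then show ?thesis
    by (rule homeomorphic_maps_imp_homeomorphic_space)
qed


section \<open>Quotient maps that are homotopy equivalences\<close>

lemma quotient_map_homotopy_descends:
  assumes q: "quotient_map X Y q"
    and h: "continuous_map (prod_topology (top_of_set {0..1::real}) X) X h"
    and fibres: "\<And>t x y. \<lbrakk>t \<in> {0..1}; x \<in> topspace X; y \<in> topspace X; q x = q y\<rbrakk> \<Longrightarrow>
      q (h (t, x)) = q (h (t, y))"
  shows "\<exists>k. continuous_map (prod_topology (top_of_set {0..1}) Y) Y k \<and>
    (\<forall>t\<in>{0..1}. \<forall>x\<in>topspace X. k (t, q x) = q (h (t, x)))"
proof -
  let ?I = "top_of_set {0..1::real}"
  have "locally_compact_space ?I" "Hausdorff_space ?I"
    by (simp_all add: compact_imp_locally_compact_space compact_space_subtopology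
        Hausdorff_space_subtopology)
  then have quotient: "quotient_map (prod_topology ?I X) (prod_topology ?I Y) (\<lambda>(t, x). (t, q x))"
    using q by (intro quotient_map_prod_right) auto
  have continuous: "continuous_map (prod_topology ?I X) Y (q \<circ> h)"
    using h quotient_imp_continuous_map[OF q] by (rule continuous_map_compose)
  have respects: "(q \<circ> h) u = (q \<circ> h) v"
    if "u \<in> topspace (prod_topology ?I X)" "v \<in> topspace (prod_topology ?I X)"
      "(\<lambda>(t, x). (t, q x)) u = (\<lambda>(t, x). (t, q x)) v" for u v
    using that fibres[of "fst u" "snd u" "snd v"] by (cases u; cases v) auto
  have "\<exists>k. continuous_map (prod_topology ?I Y) Y k \<and>
      (\<forall>u\<in>topspace (prod_topology ?I X). k ((\<lambda>(t, x). (t, q x)) u) = (q \<circ> h) u)"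
    by (rule quotient_map_lift_exists[OF quotient continuous respects]) blast+
  then obtain k where k: "continuous_map (prod_topology ?I Y) Y k"
    and k_lift: "\<forall>u\<in>topspace (prod_topology ?I X). k ((\<lambda>(t, x). (t, q x)) u) = (q \<circ> h) u"
    by blast
  have "k (t, q x) = q (h (t, x))" if "t \<in> {0..1}" "x \<in> topspace X" for t x
    using bspec[OF k_lift, of "(t, x)"] that by simp
  with k show ?thesis by blast
qed

lemma homotopy_equivalent_space_quotient:
  assumes q: "quotient_map X Y q"
    and h: "continuous_map (prod_topology (top_of_set {0..1::real}) X) X h"
    and start: "\<And>x. x \<in> topspace X \<Longrightarrow> h (0, x) = x"
    and fibres: "\<And>t x y. \<lbrakk>t \<in> {0..1}; x \<in> topspace X; y \<in> topspace X; q x = q y\<rbrakk> \<Longrightarrow>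
      q (h (t, x)) = q (h (t, y))"
    and stop: "\<And>x y. \<lbrakk>x \<in> topspace X; y \<in> topspace X; q x = q y\<rbrakk> \<Longrightarrow> h (1, x) = h (1, y)"
  shows "X homotopy_equivalent_space Y"
proof -
  have end_map: "continuous_map X X (\<lambda>x. h (1, x))"
    using continuous_map_o_Pair[OF h, of 1] by (simp add: o_def)
  have "\<exists>g. continuous_map Y X g \<and> (\<forall>x\<in>topspace X. g (q x) = h (1, x))"
    by (rule quotient_map_lift_exists[OF q end_map stop]) auto
  then obtain g where g: "continuous_map Y X g"
    and g_lift: "\<And>x. x \<in> topspace X \<Longrightarrow> g (q x) = h (1, x)"
    by blast
  have "\<exists>k. continuous_map (prod_topology (top_of_set {0..1}) Y) Y k \<and>
      (\<forall>t\<in>{0..1}. \<forall>x\<in>topspace X. k (t, q x) = q (h (t, x)))"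
    by (rule quotient_map_homotopy_descends[OF q h fibres])
  then obtain k where k: "continuous_map (prod_topology (top_of_set {0..1}) Y) Y k"
      "\<And>t x. t \<in> {0..1} \<Longrightarrow> x \<in> topspace X \<Longrightarrow> k (t, q x) = q (h (t, x))"
    by blast
  have "homotopic_with (\<lambda>x. True) X X id (g \<circ> q)"
    using h start g_lift by (subst homotopic_with) auto
  moreover have "k (0, y) = y \<and> k (1, y) = q (g y)" if "y \<in> topspace Y" for y
  proof -
    from that obtain x where "x \<in> topspace X" "y = q x"
      unfolding quotient_imp_surjective_map[OF q, symmetric] by (rule imageE)
    then show ?thesis using k(2) start g_lift by simp
  qed
  then have "homotopic_with (\<lambda>x. True) Y Y id (q \<circ> g)"
    using k(1) by (subst homotopic_with) auto
  ultimately show ?thesis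
    unfolding homotopy_equivalent_space_def
    using g quotient_imp_continuous_map[OF q]
    by (intro exI[of _ q] exI[of _ g]) (simp add: homotopic_with_sym)
qed


section \<open>Geometric realizations\<close>

definition support :: "('a \<Rightarrow> real) \<Rightarrow> 'a set" where
  "support x = {v. x v \<noteq> 0}"

definition min_coordinate :: "'a set \<Rightarrow> ('a \<Rightarrow> real) \<Rightarrow> real" where
  "min_coordinate \<sigma> x = Min (x ` \<sigma>)"

lemma min_coordinate_le: "finite \<sigma> \<Longrightarrow> v \<in> \<sigma> \<Longrightarrow> min_coordinate \<sigma> x \<le> x v"
  by (simp add: min_coordinate_def)

lemma min_coordinate_attained:
  assumes "finite \<sigma>" "\<sigma> \<noteq> {}"
  obtains v where "v \<in> \<sigma>" "x v = min_coordinate \<sigma> x"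
proof -
  have "min_coordinate \<sigma> x \<in> x ` \<sigma>"
    unfolding min_coordinate_def using assms by (intro Min_in) auto
  then show thesis
    using that by (elim imageE) simp
qed

lemma min_coordinate_nonneg:
  assumes "finite \<sigma>" "\<sigma> \<noteq> {}" and "\<And>v. v \<in> \<sigma> \<Longrightarrow> 0 \<le> x v"
  shows "0 \<le> min_coordinate \<sigma> x"
  using assms by (simp add: min_coordinate_def)

lemma min_coordinate_eq_0_iff:
  assumes "finite \<sigma>" "\<sigma> \<noteq> {}" and "\<And>v. v \<in> \<sigma> \<Longrightarrow> 0 \<le> x v"
  shows "min_coordinate \<sigma> x = 0 \<longleftrightarrow> \<not> \<sigma> \<subseteq> support x"
proof
  obtain v where "v \<in> \<sigma>" "x v = min_coordinate \<sigma> x"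
    by (rule min_coordinate_attained[OF assms(1,2)])
  moreover assume "min_coordinate \<sigma> x = 0"
  ultimately show "\<not> \<sigma> \<subseteq> support x"
    by (auto simp: support_def)
next
  assume "\<not> \<sigma> \<subseteq> support x"
  then obtain v where "v \<in> \<sigma>" "x v = 0"
    by (auto simp: support_def)
  then show "min_coordinate \<sigma> x = 0"
    using min_coordinate_le[of \<sigma> v x] min_coordinate_nonneg[of \<sigma> x] assms by auto
qed

lemma continuous_map_min_coordinate:
  assumes "finite \<sigma>" "\<sigma> \<noteq> {}" and "\<And>v. v \<in> \<sigma> \<Longrightarrow> continuous_map X euclideanreal (\<lambda>z. f z v)"
  shows "continuous_map X euclideanreal (\<lambda>z. min_coordinate \<sigma> (f z))"
  unfolding min_coordinate_def using assms
proof (induction rule: finite_ne_induct)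
  case (insert v \<sigma>)
  then have "continuous_map X euclideanreal (\<lambda>z. min (f z v) (Min (f z ` \<sigma>)))"
    by (intro continuous_map_real_min) auto
  with insert show ?case by simp
qed simp

lemma topspace_geometric_realization:
  "topspace (geometric_realization K) =
     {x. (\<forall>v. 0 \<le> x v) \<and> support x \<in> K \<and> sum x (support x) = 1}"
  by (simp add: geometric_realization_def support_def)

lemma continuous_map_geometric_realization_coordinate:
  "continuous_map (geometric_realization K) euclideanreal (\<lambda>x. x v)"
  unfolding geometric_realization_def
  by (intro continuous_map_from_subtopology continuous_map_product_projection) simp

lemma continuous_map_into_geometric_realization:
  assumes "\<And>v. continuous_map Z euclideanreal (\<lambda>z. f z v)"
    and "\<And>z. z \<in> topspace Z \<Longrightarrow> f z \<in> topspace (geometric_realization K)"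
  shows "continuous_map Z (geometric_realization K) f"
  unfolding geometric_realization_def
  by (rule continuous_map_into_subtopology)
    (use assms in \<open>auto simp: continuous_map_componentwise_UNIV topspace_geometric_realization
      support_def\<close>)

lemma continuous_map_homotopy_time:
  "continuous_map (prod_topology (top_of_set S) X) euclidean fst"
  by (rule continuous_map_into_fulltopology[OF continuous_map_fst])

lemma continuous_map_homotopy_coordinate:
  "continuous_map (prod_topology T (geometric_realization K)) euclideanreal (\<lambda>z. snd z v)"
  using continuous_map_compose[OF continuous_map_snd continuous_map_geometric_realization_coordinate]
  by (simp add: o_def)

lemma closedin_geometric_realization_face:
  "closedin (geometric_realization K) {x \<in> topspace (geometric_realization K). support x \<subseteq> \<sigma>}"
proof -
  have "closedin (geometric_realization K) {x \<in> topspace (geometric_realization K).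
      x v \<in> (if v \<in> \<sigma> then UNIV else {0})}" for v
    by (intro closedin_continuous_map_preimage[OF continuous_map_geometric_realization_coordinate]) auto
  then have "closedin (geometric_realization K) (\<Inter>v. {x \<in> topspace (geometric_realization K).
      x v \<in> (if v \<in> \<sigma> then UNIV else {0})})"
    by (intro closedin_INT) auto
  also have "(\<Inter>v. {x \<in> topspace (geometric_realization K). x v \<in> (if v \<in> \<sigma> then UNIV else {0})})
      = {x \<in> topspace (geometric_realization K). support x \<subseteq> \<sigma>}"
    by (auto simp: support_def split: if_splits)
  finally show ?thesis .
qed

lemma continuous_map_from_geometric_realization:
  assumes "finite K"
    and "\<And>\<sigma>. \<sigma> \<in> K \<Longrightarrow> continuous_map
      (subtopology (geometric_realization K)
        {x \<in> topspace (geometric_realization K). support x \<subseteq> \<sigma>}) Y f"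
  shows "continuous_map (geometric_realization K) Y f"
proof (rule pasting_lemma_closed[where I = K and f = "\<lambda>_. f"])
  show "closedin (geometric_realization K) {x \<in> topspace (geometric_realization K). support x \<subseteq> \<sigma>}" for \<sigma>
    by (rule closedin_geometric_realization_face)
  show "\<exists>\<sigma>. \<sigma> \<in> K \<and> x \<in> {x \<in> topspace (geometric_realization K). support x \<subseteq> \<sigma>} \<and> f x = f x"
    if "x \<in> topspace (geometric_realization K)" for x
    using that by (intro exI[of _ "support x"]) (auto simp: topspace_geometric_realization)
qed (use assms in auto)

locale finite_simplicial_complex =
  fixes V :: "'a set" and K :: "'a set set"
  assumes finite_vertices: "finite V"
    and faces_subset: "K \<subseteq> Pow V"
    and face_closed: "\<tau> \<in> K \<Longrightarrow> \<sigma> \<subseteq> \<tau> \<Longrightarrow> \<sigma> \<in> K"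
begin

lemma finite_complex: "finite K"
  using faces_subset finite_vertices by (simp add: finite_subset)

lemma finite_face: "\<sigma> \<in> K \<Longrightarrow> finite \<sigma>"
  using faces_subset finite_vertices finite_subset by blast

lemma in_realization_iff:
  "x \<in> topspace (geometric_realization K) \<longleftrightarrow> (\<forall>v. 0 \<le> x v) \<and> support x \<in> K \<and> sum x V = 1"
proof -
  have "sum x (support x) = sum x V" if "support x \<in> K"
    using finite_vertices faces_subset that by (intro sum.mono_neutral_left) (auto simp: support_def)
  then show ?thesis
    by (auto simp: topspace_geometric_realization)
qed

lemma coordinate_le_1:
  assumes "x \<in> topspace (geometric_realization K)"
  shows "x v \<le> 1"
proof (cases "v \<in> support x")
  case True
  with assms have "v \<in> V" "\<forall>v. 0 \<le> x v" "sum x V = 1"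
    using faces_subset by (auto simp: in_realization_iff)
  then show ?thesis
    using member_le_sum[of v V x] finite_vertices by simp
qed (simp add: support_def)

lemma compact_space_geometric_realization: "compact_space (geometric_realization K)"
proof -
  let ?P = "powertop_real (UNIV :: 'a set)"
  have projection: "continuous_map ?P euclideanreal (\<lambda>x. x v)" for v
    by (rule continuous_map_product_projection) simp
  define closed_face where "closed_face \<sigma> = {x \<in> topspace ?P. sum x V \<in> {1}} \<inter>
     (\<Inter>v. {x \<in> topspace ?P. x v \<in> (if v \<in> \<sigma> then {0..} else {0})})" for \<sigma>
  have closed_face_iff: "x \<in> closed_face \<sigma> \<longleftrightarrow> (\<forall>v. 0 \<le> x v) \<and> support x \<subseteq> \<sigma> \<and> sum x V = 1" for x \<sigma>
    by (auto simp: closed_face_def support_def) (metis order_refl)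
  have "closedin ?P (closed_face \<sigma>)" for \<sigma>
    unfolding closed_face_def
  proof (rule closedin_Int)
    show "closedin ?P {x \<in> topspace ?P. sum x V \<in> {1}}"
      using finite_vertices
      by (intro closedin_continuous_map_preimage[OF continuous_map_sum] projection) auto
    show "closedin ?P (\<Inter>v. {x \<in> topspace ?P. x v \<in> (if v \<in> \<sigma> then {0..} else {0})})"
      by (intro closedin_INT closedin_continuous_map_preimage[OF projection]) auto
  qed
  then have "closedin ?P (\<Union>\<sigma>\<in>K. closed_face \<sigma>)"
    using finite_complex by (intro closedin_Union) auto
  also have "(\<Union>\<sigma>\<in>K. closed_face \<sigma>) = topspace (geometric_realization K)"
    using face_closed by (auto simp: closed_face_iff in_realization_iff)
  finally have "closedin ?P (topspace (geometric_realization K))" .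
  moreover have "compactin ?P (PiE UNIV (\<lambda>_. {0..1::real}))"
    by (simp add: compactin_PiE)
  moreover have "topspace (geometric_realization K) \<subseteq> PiE UNIV (\<lambda>_. {0..1})"
    using coordinate_le_1 by (auto simp: in_realization_iff)
  ultimately have "compactin ?P (topspace (geometric_realization K))"
    using closed_compactin by metis
  then show ?thesis
    by (simp add: compactin_subspace geometric_realization_def)
qed

end


section \<open>Elementary collapses\<close>

definition elementary_collapse :: "'a set set \<Rightarrow> 'a set set \<Rightarrow> bool" where
  "elementary_collapse K L \<longleftrightarrow>
     (\<exists>\<sigma> a. \<sigma> \<noteq> {} \<and> a \<notin> \<sigma> \<and> insert a \<sigma> \<in> K \<and>
       (\<forall>\<rho>\<in>K. \<sigma> \<subseteq> \<rho> \<longrightarrow> \<rho> = \<sigma> \<or> \<rho> = insert a \<sigma>) \<and> L = K - {\<sigma>, insert a \<sigma>})"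

lemma elementary_collapseI:
  assumes "\<sigma> \<noteq> {}" "a \<notin> \<sigma>" "\<tau> = insert a \<sigma>" "\<tau> \<in> K"
    and "\<And>\<rho>. \<rho> \<in> K \<Longrightarrow> \<sigma> \<subseteq> \<rho> \<Longrightarrow> \<rho> \<in> {\<sigma>, \<tau>}"
  shows "elementary_collapse K (K - {\<sigma>, \<tau>})"
  using assms unfolding elementary_collapse_def by blast

definition transfer_mass :: "'a set \<Rightarrow> 'a \<Rightarrow> real \<Rightarrow> ('a \<Rightarrow> real) \<Rightarrow> 'a \<Rightarrow> real" where
  "transfer_mass \<sigma> a r x v = x v - r * of_bool (v \<in> \<sigma>) + r * card \<sigma> * of_bool (v = a)"

lemma transfer_mass_0 [simp]: "transfer_mass \<sigma> a 0 x = x"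
  by (simp add: transfer_mass_def fun_eq_iff)

lemma sum_of_bool_subset:
  assumes "finite V" "\<sigma> \<subseteq> V"
  shows "(\<Sum>v\<in>V. of_bool (v \<in> \<sigma>)) = (of_nat (card \<sigma>) :: 'b::semiring_1)"
  using assms by (simp add: sum_of_bool_eq Int_absorb1)

lemma sum_transfer_mass:
  assumes "finite V" "\<sigma> \<subseteq> V" "a \<in> V"
  shows "sum (transfer_mass \<sigma> a r x) V = sum x V"
proof -
  have "sum (transfer_mass \<sigma> a r x) V =
      sum x V - r * (\<Sum>v\<in>V. of_bool (v \<in> \<sigma>)) + r * card \<sigma> * (\<Sum>v\<in>V. of_bool (v \<in> {a}))"
    by (simp add: transfer_mass_def[abs_def] sum.distrib sum_subtractf sum_distrib_left)
  also have "\<dots> = sum x V"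
    using assms by (subst (1 2) sum_of_bool_subset) auto
  finally show ?thesis .
qed

lemma transfer_mass_nonneg:
  assumes "finite \<sigma>" "0 \<le> x v" "0 \<le> r" "r \<le> min_coordinate \<sigma> x"
  shows "0 \<le> transfer_mass \<sigma> a r x v"
proof -
  have "0 \<le> x v - r * of_bool (v \<in> \<sigma>)"
    using min_coordinate_le[of \<sigma> v x] assms by (cases "v \<in> \<sigma>") auto
  with assms show ?thesis
    by (simp add: transfer_mass_def)
qed

lemma support_transfer_mass_subset: "support (transfer_mass \<sigma> a r x) \<subseteq> insert a (support x \<union> \<sigma>)"
  by (auto simp: support_def transfer_mass_def split: if_splits)

lemma transfer_min_coordinate_clears:
  assumes "finite \<sigma>" "\<sigma> \<noteq> {}" "a \<notin> \<sigma>"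
  shows "\<not> \<sigma> \<subseteq> support (transfer_mass \<sigma> a (min_coordinate \<sigma> x) x)"
proof -
  obtain v where "v \<in> \<sigma>" "x v = min_coordinate \<sigma> x"
    by (rule min_coordinate_attained[OF assms(1,2)])
  then have "v \<in> \<sigma> - support (transfer_mass \<sigma> a (min_coordinate \<sigma> x) x)"
    using assms(3) by (auto simp: support_def transfer_mass_def)
  then show ?thesis by blast
qed

locale free_face = finite_simplicial_complex V K for V :: "'a set" and K +
  fixes \<sigma> a
  assumes nonempty: "\<sigma> \<noteq> {}"
    and apex_notin: "a \<notin> \<sigma>"
    and coface: "insert a \<sigma> \<in> K"
    and free: "\<rho> \<in> K \<Longrightarrow> \<sigma> \<subseteq> \<rho> \<Longrightarrow> \<rho> = \<sigma> \<or> \<rho> = insert a \<sigma>"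
begin

lemma finite_free_face: "finite \<sigma>"
  using finite_face[OF coface] by simp

lemma finite_simplicial_complex_collapse: "finite_simplicial_complex V (K - {\<sigma>, insert a \<sigma>})"
proof
  fix \<tau> \<rho> assume "\<tau> \<in> K - {\<sigma>, insert a \<sigma>}" "\<rho> \<subseteq> \<tau>"
  then have "\<rho> \<in> K" "\<not> \<sigma> \<subseteq> \<rho>"
    using face_closed free by blast+
  then show "\<rho> \<in> K - {\<sigma>, insert a \<sigma>}" by blast
qed (use finite_vertices faces_subset in blast)+

lemma in_realization_collapse_iff:
  "x \<in> topspace (geometric_realization (K - {\<sigma>, insert a \<sigma>})) \<longleftrightarrow>
    x \<in> topspace (geometric_realization K) \<and> min_coordinate \<sigma> x = 0"
proof -
  have "min_coordinate \<sigma> x = 0 \<longleftrightarrow> \<not> \<sigma> \<subseteq> support x" if "\<forall>v. 0 \<le> x v"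
    using that by (intro min_coordinate_eq_0_iff finite_free_face nonempty) simp
  moreover have "support x \<in> K - {\<sigma>, insert a \<sigma>} \<longleftrightarrow> support x \<in> K \<and> \<not> \<sigma> \<subseteq> support x"
    using free by blast
  ultimately show ?thesis
    by (auto simp: topspace_geometric_realization)
qed

lemma transfer_mass_in_realization:
  assumes x: "x \<in> topspace (geometric_realization K)" and r: "0 \<le> r" "r \<le> min_coordinate \<sigma> x"
  shows "transfer_mass \<sigma> a r x \<in> topspace (geometric_realization K)"
proof -
  have nonneg: "\<And>v. 0 \<le> x v"
    using x by (simp add: in_realization_iff)
  have "support (transfer_mass \<sigma> a r x) \<in> K"
  proof (cases "min_coordinate \<sigma> x = 0")
    case True
    with x r show ?thesis by (simp add: in_realization_iff)
  next
    case False
    then have "\<sigma> \<subseteq> support x"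
      using min_coordinate_eq_0_iff[OF finite_free_face nonempty] nonneg by blast
    then have "support x \<subseteq> insert a \<sigma>"
      using free[of "support x"] x by (auto simp: in_realization_iff)
    then have "support (transfer_mass \<sigma> a r x) \<subseteq> insert a \<sigma>"
      using support_transfer_mass_subset[of \<sigma> a r x] by blast
    then show ?thesis
      by (rule face_closed[OF coface])
  qed
  moreover have "insert a \<sigma> \<subseteq> V"
    using coface faces_subset by blast
  then have "sum (transfer_mass \<sigma> a r x) V = 1"
    using x finite_vertices by (simp add: sum_transfer_mass in_realization_iff)
  ultimately show ?thesis
    using transfer_mass_nonneg[OF finite_free_face nonneg r] by (simp add: in_realization_iff)
qed

text \<open>\<open>min_coordinate \<sigma> x\<close> vanishes unless \<open>x\<close> lies in the interior of \<open>\<sigma>\<close> or of \<open>insert a \<sigma>\<close>, so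
  that the homotopy only moves these points.\<close>

definition collapse_homotopy :: "real \<times> ('a \<Rightarrow> real) \<Rightarrow> 'a \<Rightarrow> real" where
  "collapse_homotopy z = transfer_mass \<sigma> a (fst z * min_coordinate \<sigma> (snd z)) (snd z)"

lemma min_coordinate_realization_nonneg:
  assumes "x \<in> topspace (geometric_realization K)"
  shows "0 \<le> min_coordinate \<sigma> x"
  using assms by (intro min_coordinate_nonneg finite_free_face nonempty) (simp add: in_realization_iff)

lemma continuous_map_collapse_homotopy:
  "continuous_map (prod_topology (top_of_set {0..1}) (geometric_realization K))
    (geometric_realization K) collapse_homotopy"
proof (rule continuous_map_into_geometric_realization)
  let ?P = "prod_topology (top_of_set {0..1::real}) (geometric_realization K)"
  show "continuous_map ?P euclideanreal (\<lambda>z. collapse_homotopy z v)" for v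
    unfolding collapse_homotopy_def transfer_mass_def
    by (intro continuous_intros continuous_map_min_coordinate finite_free_face nonempty
        continuous_map_homotopy_time continuous_map_homotopy_coordinate)
  fix z assume "z \<in> topspace ?P"
  then show "collapse_homotopy z \<in> topspace (geometric_realization K)"
    using min_coordinate_realization_nonneg[of "snd z"] unfolding collapse_homotopy_def
    by (intro transfer_mass_in_realization) (auto simp: mult_left_le_one_le)
qed

lemma collapse_homotopy_1_in_realization:
  assumes "x \<in> topspace (geometric_realization K)"
  shows "collapse_homotopy (1, x) \<in> topspace (geometric_realization (K - {\<sigma>, insert a \<sigma>}))"
proof -
  have "collapse_homotopy (1, x) \<in> topspace (geometric_realization K)"
    using transfer_mass_in_realization[OF assms min_coordinate_realization_nonneg[OF assms]]
    by (simp add: collapse_homotopy_def)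
  moreover have "\<not> \<sigma> \<subseteq> support (collapse_homotopy (1, x))"
    using transfer_min_coordinate_clears[OF finite_free_face nonempty apex_notin]
    by (simp add: collapse_homotopy_def)
  ultimately show ?thesis
    using finite_free_face nonempty
    by (simp add: in_realization_collapse_iff min_coordinate_eq_0_iff in_realization_iff)
qed

lemma homotopy_equivalent_collapse:
  "geometric_realization K homotopy_equivalent_space geometric_realization (K - {\<sigma>, insert a \<sigma>})"
proof (rule deformation_retract_imp_homotopy_equivalent_space)
  let ?X = "geometric_realization K" and ?Y = "geometric_realization (K - {\<sigma>, insert a \<sigma>})"
  let ?r = "\<lambda>x. collapse_homotopy (1, x)"
  show "homotopic_with (\<lambda>x. True) ?X ?X ?r id"
    using continuous_map_collapse_homotopy
    by (subst homotopic_with_sym, subst homotopic_with) (auto simp: collapse_homotopy_def)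
  have "continuous_map ?X euclideanreal (\<lambda>x. ?r x v)" for v
    using continuous_map_compose[OF continuous_map_o_Pair[OF continuous_map_collapse_homotopy, of 1]
        continuous_map_geometric_realization_coordinate]
    by (simp add: o_def)
  then have "continuous_map ?X ?Y ?r"
    using collapse_homotopy_1_in_realization by (rule continuous_map_into_geometric_realization)
  moreover have "continuous_map ?Y ?X id"
    by (rule continuous_map_into_geometric_realization)
      (simp_all add: continuous_map_geometric_realization_coordinate in_realization_collapse_iff)
  ultimately show "retraction_maps ?X ?Y ?r id"
    by (simp add: retraction_maps_def in_realization_collapse_iff collapse_homotopy_def)
qed

end

lemma (in finite_simplicial_complex) elementary_collapseE:
  assumes "elementary_collapse K L"
  obtains \<sigma> a where "free_face V K \<sigma> a" "L = K - {\<sigma>, insert a \<sigma>}"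
  using assms finite_simplicial_complex_axioms
  unfolding elementary_collapse_def free_face_def free_face_axioms_def by metis

lemma (in finite_simplicial_complex) homotopy_equivalent_collapses:
  assumes "elementary_collapse\<^sup>*\<^sup>* K L"
  shows "geometric_realization K homotopy_equivalent_space geometric_realization L"
proof -
  from assms have "finite_simplicial_complex V L \<and>
      geometric_realization K homotopy_equivalent_space geometric_realization L"
  proof (induction rule: rtranclp_induct)
    case base
    then show ?case
      by (simp add: finite_simplicial_complex_axioms homotopy_equivalent_space_refl)
  next
    case (step L M)
    then interpret L: finite_simplicial_complex V L by simp
    from step.hyps(2) obtain \<sigma> a where "free_face V L \<sigma> a" and M: "M = L - {\<sigma>, insert a \<sigma>}"
      by (rule L.elementary_collapseE)
    then interpret free_face V L \<sigma> a by simp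
    show ?case
      using step.IH finite_simplicial_complex_collapse homotopy_equivalent_collapse homotopy_eqv_trans
      unfolding M by blast
  qed
  then show ?thesis ..
qed

text \<open>The condition on cofaces says that \<open>rank\<close> witnesses the acyclicity of the matching.\<close>

lemma elementary_collapses_acyclic_matching:
  fixes rank :: "'i \<Rightarrow> 'b::linorder"
  assumes "finite I"
    and "\<And>v. v \<in> I \<Longrightarrow> \<sigma> v \<noteq> {} \<and> \<tau> v \<in> K \<and> (\<exists>a. a \<notin> \<sigma> v \<and> \<tau> v = insert a (\<sigma> v))"
    and "disjoint_family_on (\<lambda>v. {\<sigma> v, \<tau> v}) I"
    and "\<And>v \<rho>. \<lbrakk>v \<in> I; \<rho> \<in> K; \<sigma> v \<subseteq> \<rho>\<rbrakk> \<Longrightarrow>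
      \<rho> \<in> {\<sigma> v, \<tau> v} \<or> (\<exists>u\<in>I. rank u < rank v \<and> \<rho> \<in> {\<sigma> u, \<tau> u})"
  shows "elementary_collapse\<^sup>*\<^sup>* K (K - (\<Union>v\<in>I. {\<sigma> v, \<tau> v}))"
  using assms
proof (induction I rule: finite_ranking_induct[where f = rank])
  case empty
  then show ?case by simp
next
  case (insert w I)
  show ?case
  proof (cases "w \<in> I")
    case True
    with insert show ?thesis by (simp add: insert_absorb)
  next
    case False
    let ?L = "K - (\<Union>v\<in>I. {\<sigma> v, \<tau> v})"
    obtain a where a: "\<sigma> w \<noteq> {}" "a \<notin> \<sigma> w" "\<tau> w = insert a (\<sigma> w)" and "\<tau> w \<in> K"
      using insert.prems(1)[of w] by blast
    have "elementary_collapse\<^sup>*\<^sup>* K ?L"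
    proof (rule insert.IH)
      show "disjoint_family_on (\<lambda>v. {\<sigma> v, \<tau> v}) I"
        using insert.prems(2) by (rule disjoint_family_on_mono[rotated]) blast
      show "\<rho> \<in> {\<sigma> v, \<tau> v} \<or> (\<exists>u\<in>I. rank u < rank v \<and> \<rho> \<in> {\<sigma> u, \<tau> u})"
        if "v \<in> I" "\<rho> \<in> K" "\<sigma> v \<subseteq> \<rho>" for v \<rho>
        using insert.prems(3)[of v \<rho>] insert.hyps(2)[OF that(1)] that by (auto simp: not_less)
    qed (use insert.prems(1) in simp)
    also have "elementary_collapse ?L (?L - {\<sigma> w, \<tau> w})"
    proof (rule elementary_collapseI[OF a])
      show "\<tau> w \<in> ?L"
        using insert.prems(2) \<open>\<tau> w \<in> K\<close> False by (auto simp: disjoint_family_on_def)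
      show "\<rho> \<in> {\<sigma> w, \<tau> w}" if "\<rho> \<in> ?L" "\<sigma> w \<subseteq> \<rho>" for \<rho>
        using insert.prems(3)[of w \<rho>] that by auto
    qed
    also have "?L - {\<sigma> w, \<tau> w} = K - (\<Union>v\<in>insert w I. {\<sigma> v, \<tau> v})"
      by blast
    finally show ?thesis .
  qed
qed


section \<open>The simplex modulo its boundary\<close>

definition pole :: "nat \<Rightarrow> real" where
  "pole j = (if j = 0 then 1 else 0)"

definition sum_squares :: "nat \<Rightarrow> (nat \<Rightarrow> real) \<Rightarrow> real" where
  "sum_squares D u = (\<Sum>j\<in>{1..D}. (u j)\<^sup>2)"

text \<open>The point of the sphere whose stereographic projection from \<open>pole\<close> is \<open>u / m\<close>, with the
  denominators cleared so that \<open>m = 0\<close> is sent to \<open>pole\<close>.\<close>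

definition inverse_stereographic :: "nat \<Rightarrow> real \<Rightarrow> (nat \<Rightarrow> real) \<Rightarrow> nat \<Rightarrow> real" where
  "inverse_stereographic D m u j =
     (if j = 0 then (sum_squares D u - m\<^sup>2) / (sum_squares D u + m\<^sup>2)
      else if j \<le> D then 2 * m * u j / (sum_squares D u + m\<^sup>2) else 0)"

lemma sum_squares_nonneg: "0 \<le> sum_squares D u"
  by (simp add: sum_squares_def sum_nonneg)

lemma sum_squares_eq_0_iff: "sum_squares D u = 0 \<longleftrightarrow> (\<forall>j\<in>{1..D}. u j = 0)"
  by (simp add: sum_squares_def sum_nonneg_eq_0_iff)

lemma sum_squares_cong: "(\<And>j. j \<in> {1..D} \<Longrightarrow> u j = v j) \<Longrightarrow> sum_squares D u = sum_squares D v"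
  by (simp add: sum_squares_def)

lemma sum_squares_scale: "sum_squares D (\<lambda>j. c * u j) = c\<^sup>2 * sum_squares D u"
  by (simp add: sum_squares_def power_mult_distrib sum_distrib_left)

lemma in_nsphere_iff:
  "a \<in> topspace (nsphere D) \<longleftrightarrow> (a 0)\<^sup>2 + sum_squares D a = 1 \<and> (\<forall>j>D. a j = 0)"
proof -
  have "{..D} = insert 0 {1..D}" by auto
  then show ?thesis
    by (simp add: nsphere sum_squares_def)
qed

lemma pole_in_nsphere: "pole \<in> topspace (nsphere D)"
  by (simp add: in_nsphere_iff pole_def sum_squares_def)

lemma Hausdorff_space_nsphere: "Hausdorff_space (nsphere D)"
  unfolding nsphere
  by (intro Hausdorff_space_subtopology) (simp add: Hausdorff_space_product_topology)

lemma inverse_stereographic_in_nsphere: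
  assumes "sum_squares D u + m\<^sup>2 \<noteq> 0"
  shows "inverse_stereographic D m u \<in> topspace (nsphere D)"
proof -
  define w where "w = sum_squares D u"
  have "sum_squares D (inverse_stereographic D m u) = sum_squares D (\<lambda>j. 2 * m / (w + m\<^sup>2) * u j)"
    by (rule sum_squares_cong) (auto simp: inverse_stereographic_def w_def)
  also have "\<dots> = 4 * m\<^sup>2 * w / (w + m\<^sup>2)\<^sup>2"
    unfolding sum_squares_scale by (simp add: power_divide power_mult_distrib flip: w_def)
  finally have "(inverse_stereographic D m u 0)\<^sup>2 + sum_squares D (inverse_stereographic D m u)
      = ((w - m\<^sup>2)\<^sup>2 + 4 * m\<^sup>2 * w) / (w + m\<^sup>2)\<^sup>2"
    by (simp add: inverse_stereographic_def power_divide add_divide_distrib flip: w_def)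
  also have "(w - m\<^sup>2)\<^sup>2 + 4 * m\<^sup>2 * w = (w + m\<^sup>2)\<^sup>2"
    by algebra
  also have "\<dots> / (w + m\<^sup>2)\<^sup>2 = 1"
    using assms by (simp add: w_def)
  finally show ?thesis
    by (simp add: in_nsphere_iff) (simp add: inverse_stereographic_def)
qed

lemma inverse_stereographic_0:
  assumes "sum_squares D u \<noteq> 0"
  shows "inverse_stereographic D 0 u = pole"
  using assms by (simp add: fun_eq_iff inverse_stereographic_def pole_def)

lemma one_minus_inverse_stereographic:
  assumes "m \<noteq> 0"
  shows "1 - inverse_stereographic D m u 0 = 2 * m\<^sup>2 / (sum_squares D u + m\<^sup>2)"
proof -
  have "sum_squares D u + m\<^sup>2 \<noteq> 0"
    using assms sum_squares_nonneg[of D u] zero_less_power2[of m] by linarith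
  then show ?thesis
    by (simp add: inverse_stereographic_def field_simps)
qed

lemma inverse_stereographic_neq_pole:
  assumes "m \<noteq> 0"
  shows "inverse_stereographic D m u \<noteq> pole"
proof -
  have "0 < 2 * m\<^sup>2 / (sum_squares D u + m\<^sup>2)"
    using assms sum_squares_nonneg[of D u] by (simp add: add_nonneg_pos)
  then show ?thesis
    unfolding one_minus_inverse_stereographic[OF assms, symmetric] by (auto simp: pole_def)
qed

lemma stereographic_inverse_stereographic:
  assumes "m \<noteq> 0" and "j \<in> {1..D}"
  shows "inverse_stereographic D m u j / (1 - inverse_stereographic D m u 0) = u j / m"
proof -
  have "sum_squares D u + m\<^sup>2 \<noteq> 0"
    using assms(1) sum_squares_nonneg[of D u] zero_less_power2[of m] by linarith
  with assms show ?thesis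
    unfolding one_minus_inverse_stereographic[OF assms(1)]
    by (simp add: inverse_stereographic_def power2_eq_square)
qed

lemma inverse_stereographic_scale:
  assumes "c \<noteq> 0"
  shows "inverse_stereographic D (c * m) (\<lambda>j. c * u j) = inverse_stereographic D m u"
proof
  fix j
  have scaled: "sum_squares D (\<lambda>j. c * u j) - (c * m)\<^sup>2 = c\<^sup>2 * (sum_squares D u - m\<^sup>2)"
    "sum_squares D (\<lambda>j. c * u j) + (c * m)\<^sup>2 = c\<^sup>2 * (sum_squares D u + m\<^sup>2)"
    "2 * (c * m) * (c * u j) = c\<^sup>2 * (2 * m * u j)"
    by (simp_all add: sum_squares_scale power2_eq_square algebra_simps)
  show "inverse_stereographic D (c * m) (\<lambda>j. c * u j) j = inverse_stereographic D m u j"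
    unfolding inverse_stereographic_def scaled using assms by simp
qed

lemma inverse_stereographic_cong:
  assumes "\<And>j. j \<in> {1..D} \<Longrightarrow> u j = v j"
  shows "inverse_stereographic D m u = inverse_stereographic D m v"
proof -
  have "sum_squares D u = sum_squares D v"
    using assms by (rule sum_squares_cong)
  with assms show ?thesis
    by (auto simp: fun_eq_iff inverse_stereographic_def)
qed

lemma inverse_stereographic_of_nsphere:
  assumes a: "a \<in> topspace (nsphere D)" and "a \<noteq> pole"
  shows "a 0 < 1" and "inverse_stereographic D (1 - a 0) a = a"
proof -
  have sphere: "sum_squares D a = 1 - (a 0)\<^sup>2" and out: "\<And>j. j > D \<Longrightarrow> a j = 0"
    using a by (auto simp: in_nsphere_iff)
  then have "(a 0)\<^sup>2 \<le> 1"
    using sum_squares_nonneg[of D a] by simp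
  then have "a 0 \<le> 1"
    by (simp add: abs_square_le_1)
  moreover have "a 0 \<noteq> 1"
  proof
    assume "a 0 = 1"
    with sphere have "\<forall>j\<in>{1..D}. a j = 0"
      unfolding sum_squares_eq_0_iff[symmetric] by simp
    with \<open>a 0 = 1\<close> out have "a j = pole j" for j
      by (cases "j \<le> D") (auto simp: pole_def)
    with \<open>a \<noteq> pole\<close> show False by auto
  qed
  ultimately show "a 0 < 1" by simp
  moreover have "sum_squares D a + (1 - a 0)\<^sup>2 = 2 * (1 - a 0)"
    and "sum_squares D a - (1 - a 0)\<^sup>2 = 2 * (1 - a 0) * a 0"
    by (simp_all add: sphere power2_eq_square algebra_simps)
  ultimately show "inverse_stereographic D (1 - a 0) a = a"
    using out by (auto simp: fun_eq_iff inverse_stereographic_def)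
qed

lemma continuous_map_inverse_stereographic:
  assumes m: "continuous_map X euclideanreal m"
    and u: "\<And>j. continuous_map X euclideanreal (\<lambda>x. u x j)"
    and nondegenerate: "\<And>x. x \<in> topspace X \<Longrightarrow> sum_squares D (u x) + (m x)\<^sup>2 \<noteq> 0"
  shows "continuous_map X (nsphere D) (\<lambda>x. inverse_stereographic D (m x) (u x))"
  unfolding nsphere
proof (rule continuous_map_into_subtopology)
  have "continuous_map X euclideanreal (\<lambda>x. inverse_stereographic D (m x) (u x) j)" for j
  proof -
    have squares: "continuous_map X euclideanreal (\<lambda>x. sum_squares D (u x))"
      unfolding sum_squares_def by (intro continuous_intros u) auto
    consider "j = 0" | "0 < j" "j \<le> D" | "D < j" by linarith
    then show ?thesis
      using nondegenerate unfolding inverse_stereographic_def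
      by cases (auto intro!: continuous_intros m u squares)
  qed
  then show "continuous_map X (powertop_real UNIV) (\<lambda>x. inverse_stereographic D (m x) (u x))"
    by (simp add: continuous_map_componentwise_UNIV)
  show "(\<lambda>x. inverse_stereographic D (m x) (u x)) \<in> topspace X \<rightarrow>
      {x. (\<Sum>i\<le>D. (x i)\<^sup>2) = 1 \<and> (\<forall>i>D. x i = 0)}"
    using inverse_stereographic_in_nsphere[OF nondegenerate] by (auto simp: nsphere)
qed

lemma simplex_point_unique:
  assumes R: "finite R" "R \<noteq> {}" "r \<in> R"
    and sums: "sum x R = 1" "sum y R = 1"
    and pos: "0 < min_coordinate R x" "0 < min_coordinate R y"
    and ratio: "\<And>v. v \<in> R \<Longrightarrow> (x v - x r) / min_coordinate R x = (y v - y r) / min_coordinate R y"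
    and "v \<in> R"
  shows "x v = y v"
proof -
  define m where "m = min_coordinate R x"
  define n where "n = min_coordinate R y"
  define c where "c = x r / m - y r / n"
  have shift: "x w / m = y w / n + c" if "w \<in> R" for w
    using ratio[OF that] by (simp add: c_def m_def n_def diff_divide_distrib)
  obtain k where k: "k \<in> R" "x k = m"
    unfolding m_def by (rule min_coordinate_attained[OF R(1,2)])
  obtain l where l: "l \<in> R" "y l = n"
    unfolding n_def by (rule min_coordinate_attained[OF R(1,2)])
  have "1 \<le> y k / n" "1 \<le> x l / m"
    using min_coordinate_le[OF R(1)] k(1) l(1) pos by (simp_all add: m_def n_def)
  moreover have "1 = y k / n + c" "x l / m = 1 + c"
    using shift[OF k(1)] shift[OF l(1)] k(2) l(2) pos by (simp_all flip: m_def n_def)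
  ultimately have "c = 0" by linarith
  then have scale: "x w = m / n * y w" if "w \<in> R" for w
    using shift[OF that] pos by (simp add: field_simps flip: m_def n_def)
  then have "sum x R = m / n * sum y R"
    by (simp add: sum_distrib_left)
  with sums have "m / n = 1" by simp
  with scale[OF \<open>v \<in> R\<close>] show ?thesis by simp
qed

lemma simplex_point_exists:
  assumes R: "finite R" "R \<noteq> {}" and "0 < m"
  shows "\<exists>x c. 0 < c \<and> (\<forall>v. 0 \<le> x v) \<and> support x = R \<and> sum x R = 1 \<and> min_coordinate R x = c * m \<and>
    (\<forall>v\<in>R. \<forall>w\<in>R. x v - x w = c * (u v - u w))"
proof -
  define z where "z v = m + u v - min_coordinate R u" for v
  define c where "c = 1 / sum z R"
  define x where "x v = (if v \<in> R then c * z v else 0)" for v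
  have z: "m \<le> z v" if "v \<in> R" for v
    using min_coordinate_le[OF R(1) that] by (simp add: z_def)
  then have z_pos: "0 < z v" if "v \<in> R" for v
    using \<open>0 < m\<close> that by force
  then have "0 < sum z R"
    using R by (intro sum_pos) auto
  then have "0 < c"
    by (simp add: c_def)
  obtain k where "k \<in> R" "u k = min_coordinate R u"
    by (rule min_coordinate_attained[OF R])
  then have "x k = c * m"
    by (simp add: x_def z_def)
  then have "min_coordinate R x = c * m"
    unfolding min_coordinate_def using R(1) z \<open>0 < c\<close> \<open>k \<in> R\<close>
    by (intro Min_eqI) (auto simp: x_def intro!: image_eqI[of _ _ k])
  moreover have "support x = R" "\<forall>v. 0 \<le> x v"
    using z_pos \<open>0 < c\<close> by (force simp: support_def x_def)+
  moreover have "sum x R = c * sum z R"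
    by (simp add: x_def sum_distrib_left)
  then have "sum x R = 1"
    using \<open>0 < sum z R\<close> by (simp add: c_def)
  moreover have "\<forall>v\<in>R. \<forall>w\<in>R. x v - x w = c * (u v - u w)"
    by (simp add: x_def z_def algebra_simps)
  ultimately show ?thesis
    using \<open>0 < c\<close> by blast
qed

text \<open>The simplex with vertex set \<open>R\<close> is scaled by the reciprocal of its least coordinate, which
  carries its interior onto Euclidean space and its boundary to infinity.\<close>

definition simplex_to_sphere :: "'a set \<Rightarrow> ('a \<Rightarrow> real) \<Rightarrow> nat \<Rightarrow> real" where
  "simplex_to_sphere R x = inverse_stereographic (card R - 1) (min_coordinate R x)
     (\<lambda>j. x (from_nat_into R j) - x (from_nat_into R 0))"

locale cell =
  fixes R :: "'a set"
  assumes finite_cell: "finite R" and cell_nonempty: "R \<noteq> {}"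
begin

lemma bij_betw_vertices: "bij_betw (from_nat_into R) {..card R - 1} R"
proof -
  have "Suc (card R - 1) = card R"
    using finite_cell cell_nonempty by (simp add: card_gt_0_iff)
  then show ?thesis
    using bij_betw_from_nat_into_finite[OF finite_cell] by (metis lessThan_Suc_atMost)
qed

lemma vertexE:
  assumes "v \<in> R"
  obtains j where "j \<le> card R - 1" "v = from_nat_into R j"
  using assms bij_betw_imp_surj_on[OF bij_betw_vertices] by blast

lemma simplex_to_sphere_nondegenerate:
  assumes "\<And>v. v \<in> R \<Longrightarrow> 0 \<le> x v" and "sum x R = 1"
  shows "sum_squares (card R - 1) (\<lambda>j. x (from_nat_into R j) - x (from_nat_into R 0))
    + (min_coordinate R x)\<^sup>2 \<noteq> 0" (is "?w + _ \<noteq> 0")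
proof
  assume "?w + (min_coordinate R x)\<^sup>2 = 0"
  then have "?w = 0" and "min_coordinate R x = 0"
    using sum_squares_nonneg by (simp_all add: add_nonneg_eq_0_iff)
  then have const: "x (from_nat_into R j) = x (from_nat_into R 0)" if "j \<le> card R - 1" for j
    using that by (cases "j = 0") (auto simp: sum_squares_eq_0_iff)
  obtain k where k: "k \<in> R" "x k = 0"
    using min_coordinate_attained[OF finite_cell cell_nonempty, of x] \<open>min_coordinate R x = 0\<close> by auto
  have "x v = 0" if "v \<in> R" for v
    using const k by (metis that vertexE)
  then have "sum x R = 0" by simp
  with assms(2) show False by simp
qed

lemma simplex_to_sphere_boundary:
  assumes "\<And>v. v \<in> R \<Longrightarrow> 0 \<le> x v" and "sum x R = 1" and "min_coordinate R x = 0"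
  shows "simplex_to_sphere R x = pole"
  using simplex_to_sphere_nondegenerate[OF assms(1,2)] assms(3)
  by (simp add: simplex_to_sphere_def inverse_stereographic_0)

lemma simplex_to_sphere_interior:
  assumes "0 < min_coordinate R x"
  shows "simplex_to_sphere R x \<noteq> pole"
  using assms by (simp add: simplex_to_sphere_def inverse_stereographic_neq_pole)

lemma simplex_to_sphere_inj:
  assumes "sum x R = 1" "sum y R = 1" and pos: "0 < min_coordinate R x" "0 < min_coordinate R y"
    and eq: "simplex_to_sphere R x = simplex_to_sphere R y" and "v \<in> R"
  shows "x v = y v"
proof (rule simplex_point_unique[where r = "from_nat_into R 0"])
  let ?e = "from_nat_into R"
  show "?e 0 \<in> R"
    using cell_nonempty by (rule from_nat_into)
  have ratio: "(z (?e j) - z (?e 0)) / min_coordinate R z =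
      simplex_to_sphere R z j / (1 - simplex_to_sphere R z 0)"
    if "0 < min_coordinate R z" "j \<in> {1..card R - 1}" for z j
    using that by (simp add: simplex_to_sphere_def stereographic_inverse_stereographic)
  fix w assume "w \<in> R"
  then obtain j where "j \<le> card R - 1" "w = ?e j"
    by (rule vertexE)
  then show "(x w - x (?e 0)) / min_coordinate R x = (y w - y (?e 0)) / min_coordinate R y"
    using ratio[OF pos(1), of j] ratio[OF pos(2), of j] eq by (cases "j = 0") auto
qed (use assms finite_cell cell_nonempty in auto)

lemma simplex_to_sphere_surj:
  assumes a: "a \<in> topspace (nsphere (card R - 1))" "a \<noteq> pole"
  obtains x where "\<forall>v. 0 \<le> x v" "support x = R" "sum x R = 1" "simplex_to_sphere R x = a"
proof -
  let ?e = "from_nat_into R"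
  define u where "u v = (let j = inv_into {..card R - 1} ?e v in if j = 0 then 0 else a j)" for v
  have u: "u (?e j) = (if j = 0 then 0 else a j)" if "j \<le> card R - 1" for j
    using bij_betw_inv_into_left[OF bij_betw_vertices, of j] that by (simp add: u_def Let_def)
  have "0 < 1 - a 0"
    using inverse_stereographic_of_nsphere(1)[OF a] by simp
  from simplex_point_exists[OF finite_cell cell_nonempty this, of u]
  obtain x c where x: "0 < c" "\<forall>v. 0 \<le> x v" "support x = R" "sum x R = 1"
    and min: "min_coordinate R x = c * (1 - a 0)"
    and diff: "\<And>v w. v \<in> R \<Longrightarrow> w \<in> R \<Longrightarrow> x v - x w = c * (u v - u w)"
    by blast
  have "x (?e j) - x (?e 0) = c * a j" if "j \<in> {1..card R - 1}" for j
    using diff[OF from_nat_into[OF cell_nonempty] from_nat_into[OF cell_nonempty], of j 0]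
      u[of j] u[of 0] that by simp
  then have "simplex_to_sphere R x = inverse_stereographic (card R - 1) (c * (1 - a 0)) (\<lambda>j. c * a j)"
    unfolding simplex_to_sphere_def min by (rule inverse_stereographic_cong)
  also have "\<dots> = a"
    using x(1) inverse_stereographic_of_nsphere(2)[OF a] by (simp add: inverse_stereographic_scale)
  finally show thesis
    using x by (intro that[of x]) auto
qed

lemma continuous_map_simplex_to_sphere:
  assumes "\<And>v. continuous_map X euclideanreal (\<lambda>z. f z v)"
    and "\<And>z v. z \<in> topspace X \<Longrightarrow> v \<in> R \<Longrightarrow> 0 \<le> f z v" and "\<And>z. z \<in> topspace X \<Longrightarrow> sum (f z) R = 1"
  shows "continuous_map X (nsphere (card R - 1)) (\<lambda>z. simplex_to_sphere R (f z))"
  unfolding simplex_to_sphere_def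
proof (rule continuous_map_inverse_stereographic)
  show "continuous_map X euclideanreal (\<lambda>z. min_coordinate R (f z))"
    by (intro continuous_map_min_coordinate finite_cell cell_nonempty assms(1))
  show "continuous_map X euclideanreal (\<lambda>z. f z (from_nat_into R j) - f z (from_nat_into R 0))" for j
    by (intro continuous_intros assms(1))
qed (use simplex_to_sphere_nondegenerate assms(2,3) in auto)

end


section \<open>Cones with attached simplices\<close>

lemma sum_eq_1_if_support_subset:
  assumes "x \<in> topspace (geometric_realization K)" "finite \<sigma>" "support x \<subseteq> \<sigma>"
  shows "sum x \<sigma> = 1"
proof -
  have "sum x (support x) = sum x \<sigma>"
    using assms(2,3) by (intro sum.mono_neutral_left) (auto simp: support_def)
  with assms(1) show ?thesis
    by (simp add: topspace_geometric_realization)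
qed

locale cone_with_cells = finite_simplicial_complex V K for V :: "'a set" and K +
  fixes p :: 'a and S :: "'a set set"
  assumes empty_face: "{} \<in> K"
    and cone: "\<sigma> \<in> K \<Longrightarrow> insert p \<sigma> \<in> K"
    and cell_subset: "R \<in> S \<Longrightarrow> R \<subseteq> V"
    and cell_notin: "R \<in> S \<Longrightarrow> R \<notin> K"
    and cell_boundary: "R \<in> S \<Longrightarrow> \<sigma> \<subset> R \<Longrightarrow> \<sigma> \<in> K"

sublocale cone_with_cells \<subseteq> total: finite_simplicial_complex V "K \<union> S"
proof
  show "\<sigma> \<in> K \<union> S" if "\<tau> \<in> K \<union> S" "\<sigma> \<subseteq> \<tau>" for \<sigma> \<tau>
    using that face_closed[of \<tau> \<sigma>] cell_boundary[of \<tau> \<sigma>] by (cases "\<sigma> = \<tau>") auto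
qed (use finite_vertices faces_subset cell_subset in auto)

context cone_with_cells
begin

abbreviation total_space :: "('a \<Rightarrow> real) topology" where
  "total_space \<equiv> geometric_realization (K \<union> S)"

lemma in_cone_iff: "x \<in> topspace (geometric_realization K) \<longleftrightarrow> x \<in> topspace total_space \<and> support x \<in> K"
  by (auto simp: topspace_geometric_realization)

lemma cone_or_cell:
  assumes "x \<in> topspace total_space"
  obtains (in_cone) "x \<in> topspace (geometric_realization K)" | (in_cell) "support x \<in> S"
  using assms by (auto simp: topspace_geometric_realization)

lemma finite_cells: "finite S"
  using total.finite_complex by simp

lemma cell_interpretation: "R \<in> S \<Longrightarrow> cell R"
  using total.finite_face[of R] cell_notin empty_face by unfold_locales auto

lemma cell_minimal:
  assumes "R \<in> S" "R \<subseteq> \<tau>" "\<tau> \<in> K \<union> S"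
  shows "\<tau> = R"
  using assms face_closed cell_notin cell_boundary[of \<tau> R] by blast

lemma min_coordinate_cell:
  assumes "R \<in> S" "x \<in> topspace total_space"
  shows "0 \<le> min_coordinate R x" and "min_coordinate R x = 0 \<longleftrightarrow> support x \<noteq> R"
proof -
  interpret cell R by (rule cell_interpretation[OF assms(1)])
  have nonneg: "\<And>v. 0 \<le> x v" and "support x \<in> K \<union> S"
    using assms(2) by (simp_all add: topspace_geometric_realization)
  then have "support x = R \<longleftrightarrow> R \<subseteq> support x"
    using cell_minimal[OF assms(1)] by blast
  then show "min_coordinate R x = 0 \<longleftrightarrow> support x \<noteq> R"
    using min_coordinate_eq_0_iff[OF finite_cell cell_nonempty] nonneg by simp
  show "0 \<le> min_coordinate R x"
    using min_coordinate_nonneg[OF finite_cell cell_nonempty] nonneg by simp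
qed

definition collapse_cone :: "('a \<Rightarrow> real) \<Rightarrow> ('a set \<times> (nat \<Rightarrow> real)) option" where
  "collapse_cone x = (if support x \<in> K then None
     else wedge_proj (\<lambda>_. pole) (support x, simplex_to_sphere (support x) x))"

abbreviation cell_wedge :: "('a set \<times> (nat \<Rightarrow> real)) option topology" where
  "cell_wedge \<equiv> wedge (\<lambda>R. nsphere (card R - 1)) (\<lambda>_. pole) S"

lemma collapse_cone_closed_cell:
  assumes R: "R \<in> S" and x: "x \<in> topspace total_space" "support x \<subseteq> R"
  shows "collapse_cone x = wedge_proj (\<lambda>_. pole) (R, simplex_to_sphere R x)"
proof (cases "support x = R")
  case True
  with cell_notin[OF R] show ?thesis
    by (simp add: collapse_cone_def)
next
  case False
  interpret cell R by (rule cell_interpretation[OF R])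
  have "simplex_to_sphere R x = pole"
  proof (rule simplex_to_sphere_boundary)
    show "sum x R = 1"
      using x by (intro sum_eq_1_if_support_subset finite_cell)
  qed (use x False min_coordinate_cell[OF R x(1)] in \<open>auto simp: topspace_geometric_realization\<close>)
  moreover have "support x \<in> K"
    using cell_boundary[OF R] x(2) False by blast
  ultimately show ?thesis
    by (simp add: collapse_cone_def wedge_proj_def)
qed

lemma collapse_cone_open_cell:
  assumes "x \<in> topspace total_space" "support x \<in> S"
  shows "collapse_cone x = Some (support x, simplex_to_sphere (support x) x)"
proof -
  interpret cell "support x" by (rule cell_interpretation[OF assms(2)])
  have "0 < min_coordinate (support x) x"
    using min_coordinate_cell[OF assms(2,1)] by simp
  then show ?thesis
    using collapse_cone_closed_cell[OF assms(2,1)] simplex_to_sphere_interior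
    by (simp add: wedge_proj_def)
qed

lemma collapse_cone_eqD:
  assumes x: "x \<in> topspace total_space" and y: "y \<in> topspace total_space"
    and eq: "collapse_cone x = collapse_cone y"
  shows "x = y \<or> x \<in> topspace (geometric_realization K) \<and> y \<in> topspace (geometric_realization K)"
proof (cases "support x \<in> K \<or> support y \<in> K")
  case True
  have "support z \<in> S" if "z \<in> topspace total_space" "support z \<notin> K" for z
    using that by (auto simp: topspace_geometric_realization)
  then have "support x \<in> K \<and> support y \<in> K"
    using True x y eq collapse_cone_open_cell[of x] collapse_cone_open_cell[of y]
    by (auto simp: collapse_cone_def split: if_splits)
  with x y show ?thesis by (simp add: in_cone_iff)
next
  case False
  with x y have cells: "support x \<in> S" "support y \<in> S"
    by (auto simp: topspace_geometric_realization)
  then have same: "support y = support x"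
    and spheres: "simplex_to_sphere (support x) x = simplex_to_sphere (support x) y"
    using eq collapse_cone_open_cell[OF x] collapse_cone_open_cell[OF y] by auto
  interpret cell "support x" by (rule cell_interpretation[OF cells(1)])
  have "x v = y v" for v
  proof (cases "v \<in> support x")
    case True
    show ?thesis
    proof (rule simplex_to_sphere_inj[OF _ _ _ _ spheres True])
      show "0 < min_coordinate (support x) x" "0 < min_coordinate (support x) y"
        using min_coordinate_cell[OF cells(1) x] min_coordinate_cell[OF cells(1) y] same by simp_all
    qed (use x y same in \<open>auto simp: topspace_geometric_realization\<close>)
  next
    case False
    with same show ?thesis by (auto simp: support_def)
  qed
  then show ?thesis by auto
qed

lemma continuous_map_collapse_cone: "continuous_map total_space cell_wedge collapse_cone"
proof (rule continuous_map_from_geometric_realization)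
  fix \<sigma>
  let ?F = "subtopology total_space {x \<in> topspace total_space. support x \<subseteq> \<sigma>}"
  assume "\<sigma> \<in> K \<union> S"
  then show "continuous_map ?F cell_wedge collapse_cone"
  proof
    assume "\<sigma> \<in> K"
    have "continuous_map ?F cell_wedge (\<lambda>_. None)"
      by (simp add: topspace_wedge)
    then show ?thesis
      by (rule continuous_map_eq) (use \<open>\<sigma> \<in> K\<close> face_closed in \<open>auto simp: collapse_cone_def\<close>)
  next
    assume R: "\<sigma> \<in> S"
    interpret cell \<sigma> by (rule cell_interpretation[OF R])
    have "continuous_map ?F (nsphere (card \<sigma> - 1)) (simplex_to_sphere \<sigma>)"
    proof (rule continuous_map_simplex_to_sphere)
      show "continuous_map ?F euclideanreal (\<lambda>x. x v)" for v
        by (intro continuous_map_from_subtopology continuous_map_geometric_realization_coordinate)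
      show "sum x \<sigma> = 1" if "x \<in> topspace ?F" for x
        using that finite_cell by (auto intro: sum_eq_1_if_support_subset)
    qed (auto simp: topspace_geometric_realization)
    moreover have "continuous_map (nsphere (card \<sigma> - 1)) cell_wedge (\<lambda>a. wedge_proj (\<lambda>_. pole) (\<sigma>, a))"
      by (rule continuous_map_wedge_inclusion[OF R])
    ultimately have "continuous_map ?F cell_wedge
        ((\<lambda>a. wedge_proj (\<lambda>_. pole) (\<sigma>, a)) \<circ> simplex_to_sphere \<sigma>)"
      by (rule continuous_map_compose)
    then have "continuous_map ?F cell_wedge (\<lambda>x. wedge_proj (\<lambda>_. pole) (\<sigma>, simplex_to_sphere \<sigma> x))"
      by (simp add: o_def)
    then show ?thesis
      by (rule continuous_map_eq) (auto simp: collapse_cone_closed_cell[OF R])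
  qed
qed (rule total.finite_complex)

lemma apex_in_cone: "(\<lambda>v. of_bool (v = p)) \<in> topspace (geometric_realization K)"
proof -
  have "support (\<lambda>v. of_bool (v = p)) = {p}"
    by (auto simp: support_def)
  then show ?thesis
    using cone[OF empty_face] by (simp add: topspace_geometric_realization)
qed

lemma collapse_cone_surj: "collapse_cone ` topspace total_space = topspace cell_wedge"
proof
  show "collapse_cone ` topspace total_space \<subseteq> topspace cell_wedge"
    by (rule continuous_map_image_subset_topspace[OF continuous_map_collapse_cone])
  show "topspace cell_wedge \<subseteq> collapse_cone ` topspace total_space"
  proof
    fix w assume w: "w \<in> topspace cell_wedge"
    show "w \<in> collapse_cone ` topspace total_space"
    proof (cases w)
      case None
      with apex_in_cone show ?thesis
        unfolding in_cone_iff
        by (intro image_eqI[of _ _ "\<lambda>v. of_bool (v = p)"]) (auto simp: collapse_cone_def)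
    next
      case (Some z)
      then obtain R a where w_eq: "w = Some (R, a)" by (cases z) auto
      with w have R: "R \<in> S" and a: "a \<in> topspace (nsphere (card R - 1))" "a \<noteq> pole"
        by (simp_all add: Some_in_topspace_wedge_iff)
      interpret cell R by (rule cell_interpretation[OF R])
      obtain x where "\<forall>v. 0 \<le> x v" "support x = R" "sum x R = 1" "simplex_to_sphere R x = a"
        by (rule simplex_to_sphere_surj[OF a])
      then have "x \<in> topspace total_space" "collapse_cone x = w"
        using R collapse_cone_open_cell[of x] by (auto simp: topspace_geometric_realization w_eq)
      then show ?thesis by blast
    qed
  qed
qed

lemma quotient_map_collapse_cone: "quotient_map total_space cell_wedge collapse_cone"
proof (rule continuous_closed_imp_quotient_map)
  have "Hausdorff_space cell_wedge"
    by (intro Hausdorff_space_wedge Hausdorff_space_nsphere pole_in_nsphere)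
  then show "closed_map total_space cell_wedge collapse_cone"
    by (intro continuous_imp_closed_map_gen continuous_map_collapse_cone Hausdorff_imp_kc_space
        total.compact_space_geometric_realization)
qed (rule continuous_map_collapse_cone collapse_cone_surj)+

text \<open>To contract the cone inside \<open>total_space\<close>, a point of a cell \<open>R\<close> first moves away from the
  barycentre: it loses the mass \<open>collar R t x\<close> at every vertex of \<open>R\<close>. Once it has reached the
  boundary, it uses what is left of the time \<open>t\<close> to move towards the apex.\<close>

definition collar :: "'a set \<Rightarrow> real \<Rightarrow> ('a \<Rightarrow> real) \<Rightarrow> real" where
  "collar R t x = min (min_coordinate R x) (t / (2 * card R))"

definition collar_mass :: "real \<Rightarrow> ('a \<Rightarrow> real) \<Rightarrow> real" where
  "collar_mass t x = (\<Sum>R\<in>S. card R * collar R t x)"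

definition push_out :: "real \<Rightarrow> ('a \<Rightarrow> real) \<Rightarrow> 'a \<Rightarrow> real" where
  "push_out t x v = (x v - (\<Sum>R\<in>S. of_bool (v \<in> R) * collar R t x)) / (1 - collar_mass t x)"

definition contraction :: "real \<times> ('a \<Rightarrow> real) \<Rightarrow> 'a \<Rightarrow> real" where
  "contraction z v = (let s = fst z - 2 * collar_mass (fst z) (snd z) in
     (1 - s) * push_out (fst z) (snd z) v + s * of_bool (v = p))"

lemma collar_nonneg:
  assumes "R \<in> S" "x \<in> topspace total_space" "0 \<le> t"
  shows "0 \<le> collar R t x"
  using assms min_coordinate_cell(1) by (simp add: collar_def)

lemma collar_eq_0:
  assumes "R \<in> S" "x \<in> topspace total_space" "0 \<le> t" "support x \<noteq> R"
  shows "collar R t x = 0"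
  using assms min_coordinate_cell[of R x] by (simp add: collar_def)

lemma sum_collar_cone:
  assumes "x \<in> topspace (geometric_realization K)" "0 \<le> t"
  shows "(\<Sum>R\<in>S. f R * collar R t x) = 0"
  using assms collar_eq_0 cell_notin by (intro sum.neutral) (auto simp: in_cone_iff)

lemma sum_collar_cell:
  assumes "x \<in> topspace total_space" "support x \<in> S" "0 \<le> t"
  shows "(\<Sum>R\<in>S. f R * collar R t x) = f (support x) * collar (support x) t x"
proof -
  have "(\<Sum>R\<in>S. f R * collar R t x) = (\<Sum>R\<in>{support x}. f R * collar R t x)"
    using assms finite_cells collar_eq_0 by (intro sum.mono_neutral_right) auto
  then show ?thesis by simp
qed

lemma collar_mass_bounds:
  assumes "x \<in> topspace total_space" "0 \<le> t"
  shows "0 \<le> collar_mass t x" and "collar_mass t x \<le> t / 2"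
proof -
  show "0 \<le> collar_mass t x"
    unfolding collar_mass_def using assms collar_nonneg by (intro sum_nonneg) auto
  from assms(1) show "collar_mass t x \<le> t / 2"
  proof (cases rule: cone_or_cell)
    case in_cone
    with assms(2) show ?thesis
      by (simp add: collar_mass_def sum_collar_cone)
  next
    case in_cell
    interpret cell "support x" by (rule cell_interpretation[OF in_cell])
    have "card (support x) * collar (support x) t x \<le> card (support x) * (t / (2 * card (support x)))"
      by (intro mult_left_mono) (simp_all add: collar_def)
    also have "\<dots> = t / 2"
      using finite_cell cell_nonempty by (simp add: card_gt_0_iff)
    finally show ?thesis
      using assms in_cell by (simp add: collar_mass_def sum_collar_cell)
  qed
qed

lemma push_out_cone:
  assumes "x \<in> topspace (geometric_realization K)" "0 \<le> t"
  shows "push_out t x = x"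
  using assms by (simp add: fun_eq_iff push_out_def collar_mass_def sum_collar_cone)

lemma push_out_cell:
  assumes "x \<in> topspace total_space" "support x \<in> S" "0 \<le> t"
  shows "push_out t x v =
    (x v - of_bool (v \<in> support x) * collar (support x) t x) / (1 - collar_mass t x)"
  using assms by (simp add: push_out_def sum_collar_cell)

lemma support_push_out_cell:
  assumes "x \<in> topspace total_space" "support x \<in> S" "0 \<le> t"
  shows "support (push_out t x) \<subseteq> support x"
  using assms by (auto simp: push_out_cell support_def)

lemma push_out_in_realization:
  assumes x: "x \<in> topspace total_space" and t: "t \<in> {0..1}"
  shows "push_out t x \<in> topspace total_space"
  using x
proof (cases rule: cone_or_cell)
  case in_cone
  with t show ?thesis
    by (simp add: push_out_cone in_cone_iff)
next
  case in_cell
  note cell = x in_cell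
  interpret cell "support x" by (rule cell_interpretation[OF in_cell])
  have mass: "collar_mass t x = card (support x) * collar (support x) t x"
    using cell t by (simp add: collar_mass_def sum_collar_cell)
  have mass_less: "collar_mass t x < 1"
    using collar_mass_bounds(2)[OF x, of t] t by simp
  have "0 \<le> push_out t x v" for v
  proof -
    have "collar (support x) t x \<le> x v" if "v \<in> support x"
      using min_coordinate_le[OF finite_cell that, of x]
      by (simp add: collar_def)
    with x t mass_less show ?thesis
      by (simp add: push_out_cell[OF cell] topspace_geometric_realization)
  qed
  moreover have "support (push_out t x) \<in> K \<union> S"
    using in_cell t by (intro total.face_closed[OF _ support_push_out_cell[OF cell]]) auto
  moreover have "sum (push_out t x) V = 1"
  proof -
    have "(\<Sum>v\<in>V. of_bool (v \<in> support x)) = real (card (support x))"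
      using cell_subset[OF in_cell] by (rule sum_of_bool_subset[OF total.finite_vertices])
    then have "(\<Sum>v\<in>V. x v - of_bool (v \<in> support x) * collar (support x) t x) = 1 - collar_mass t x"
      using x unfolding mass
      by (simp add: sum_subtractf total.in_realization_iff flip: sum_distrib_right)
    with t mass_less show ?thesis
      by (simp add: push_out_cell[OF cell] flip: sum_divide_distrib)
  qed
  ultimately show ?thesis
    by (simp add: total.in_realization_iff)
qed

lemma push_out_reaches_cone:
  assumes x: "x \<in> topspace total_space" and t: "t \<in> {0..1}" and late: "2 * collar_mass t x \<noteq> t"
  shows "push_out t x \<in> topspace (geometric_realization K)"
  using x
proof (cases rule: cone_or_cell)
  case in_cone
  with t show ?thesis
    by (simp add: push_out_cone)
next
  case in_cell
  note cell = x in_cell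
  interpret cell "support x" by (rule cell_interpretation[OF in_cell])
  have "collar_mass t x = card (support x) * collar (support x) t x"
    using cell t by (simp add: collar_mass_def sum_collar_cell)
  moreover have "2 * (card (support x) * (t / (2 * card (support x)))) = t"
    using finite_cell cell_nonempty by simp
  ultimately have "collar (support x) t x \<noteq> t / (2 * card (support x))"
    using late by metis
  then have collar: "collar (support x) t x = min_coordinate (support x) x"
    by (auto simp: collar_def min_def split: if_splits)
  obtain v where v: "v \<in> support x" "x v = min_coordinate (support x) x"
    by (rule min_coordinate_attained[OF finite_cell cell_nonempty])
  then have "push_out t x v = 0"
    using cell t by (simp add: push_out_cell collar)
  then have "support (push_out t x) \<subset> support x"
    using support_push_out_cell[OF cell] t v(1) by (auto simp: support_def)
  then have "support (push_out t x) \<in> K"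
    by (rule cell_boundary[OF in_cell])
  with push_out_in_realization[OF x t] show ?thesis
    by (simp add: in_cone_iff)
qed

lemma segment_to_apex_in_cone:
  assumes x: "x \<in> topspace (geometric_realization K)" and s: "0 \<le> s" "s \<le> 1"
  shows "(\<lambda>v. (1 - s) * x v + s * of_bool (v = p)) \<in> topspace (geometric_realization K)"
    (is "?y \<in> _")
proof -
  have "insert p (support x) \<in> K"
    using x cone by (simp add: in_realization_iff)
  then have "p \<in> V" and "support ?y \<in> K"
    using faces_subset by (auto simp: support_def intro: face_closed[of "insert p {v. x v \<noteq> 0}"])
  moreover have "sum ?y V = (1 - s) * sum x V + s * (\<Sum>v\<in>V. of_bool (v \<in> {p}))"
    by (simp add: sum.distrib sum_distrib_left)
  moreover have "(\<Sum>v\<in>V. of_bool (v \<in> {p})) = real (card {p})"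
    using \<open>p \<in> V\<close> by (intro sum_of_bool_subset finite_vertices) simp
  ultimately show ?thesis
    using x s by (simp add: in_realization_iff)
qed

lemma contraction_0:
  assumes "x \<in> topspace total_space"
  shows "contraction (0, x) = x"
proof -
  have "collar R 0 x = 0" if "R \<in> S" for R
    using min_coordinate_cell(1)[OF that assms] by (simp add: collar_def)
  then show ?thesis
    by (simp add: fun_eq_iff contraction_def push_out_def collar_mass_def)
qed

lemma contraction_cone:
  assumes "x \<in> topspace (geometric_realization K)" "0 \<le> t"
  shows "contraction (t, x) = (\<lambda>v. (1 - t) * x v + t * of_bool (v = p))"
  using assms by (simp add: fun_eq_iff contraction_def push_out_cone collar_mass_def sum_collar_cone)

lemma contraction_in_realization:
  assumes x: "x \<in> topspace total_space" and t: "t \<in> {0..1}"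
  shows "contraction (t, x) \<in> topspace total_space"
proof (cases "2 * collar_mass t x = t")
  case True
  then have "contraction (t, x) = push_out t x"
    by (simp add: fun_eq_iff contraction_def)
  with push_out_in_realization[OF x t] show ?thesis by simp
next
  case False
  have "contraction (t, x) \<in> topspace (geometric_realization K)"
    using segment_to_apex_in_cone[OF push_out_reaches_cone[OF x t False], of "t - 2 * collar_mass t x"]
      collar_mass_bounds[OF x, of t] t
    by (simp add: contraction_def[abs_def] Let_def)
  then show ?thesis by (simp add: in_cone_iff)
qed

lemma continuous_map_contraction:
  "continuous_map (prod_topology (top_of_set {0..1}) total_space) total_space contraction"
proof (rule continuous_map_into_geometric_realization)
  let ?P = "prod_topology (top_of_set {0..1::real}) total_space"
  note time = continuous_map_homotopy_time[of "{0..1::real}" total_space]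
  note coordinate = continuous_map_homotopy_coordinate[of "top_of_set {0..1::real}" "K \<union> S"]
  have collar: "continuous_map ?P euclideanreal (\<lambda>z. collar R (fst z) (snd z))" if "R \<in> S" for R
  proof -
    interpret cell R by (rule cell_interpretation[OF that])
    show ?thesis
      unfolding collar_def using finite_cell cell_nonempty
      by (intro continuous_intros continuous_map_min_coordinate time coordinate) auto
  qed
  then have mass: "continuous_map ?P euclideanreal (\<lambda>z. collar_mass (fst z) (snd z))"
    unfolding collar_mass_def by (intro continuous_intros finite_cells)
  have "1 - collar_mass (fst z) (snd z) \<noteq> 0" if "z \<in> topspace ?P" for z
    using that collar_mass_bounds[of "snd z" "fst z"] by auto
  then show "continuous_map ?P euclideanreal (\<lambda>z. contraction z v)" for v
    unfolding contraction_def push_out_def Let_def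
    by (intro continuous_intros time coordinate collar mass finite_cells)
  show "contraction z \<in> topspace total_space" if "z \<in> topspace ?P" for z
    using that contraction_in_realization[of "snd z" "fst z"] by auto
qed

lemma homotopy_equivalent_wedge_of_cells: "total_space homotopy_equivalent_space cell_wedge"
proof (rule homotopy_equivalent_space_quotient[OF quotient_map_collapse_cone continuous_map_contraction])
  show "contraction (0, x) = x" if "x \<in> topspace total_space" for x
    using that by (rule contraction_0)
  fix x y
  assume xy: "x \<in> topspace total_space" "y \<in> topspace total_space" "collapse_cone x = collapse_cone y"
  have base: "collapse_cone (contraction (t, z)) = None"
    if "z \<in> topspace (geometric_realization K)" "t \<in> {0..1}" for z t
    using that segment_to_apex_in_cone[of z t] contraction_cone[of z t]
    by (simp add: collapse_cone_def in_cone_iff)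
  show "collapse_cone (contraction (t, x)) = collapse_cone (contraction (t, y))" if "t \<in> {0..1}" for t
    using collapse_cone_eqD[OF xy] base[OF _ that] by auto
  show "contraction (1, x) = contraction (1, y)"
    using collapse_cone_eqD[OF xy] contraction_cone[of x 1] contraction_cone[of y 1] by auto
qed

end

theorem homotopy_equivalent_wedge_of_spheres:
  assumes "cone_with_cells V K p S" and card: "\<And>R. R \<in> S \<Longrightarrow> card R = Suc D"
  shows "geometric_realization (K \<union> S) homotopy_equivalent_space wedge_of_spheres (card S) D"
proof -
  interpret cone_with_cells V K p S by fact
  obtain f where f: "bij_betw f S {..<card S}"
    using ex_bij_betw_finite_nat[OF finite_cells] unfolding atLeast0LessThan by blast
  have "wedge (\<lambda>R. nsphere (card R - 1)) (\<lambda>_. pole) S homeomorphic_space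
      wedge (\<lambda>_. nsphere D) (\<lambda>_. pole) {..<card S}"
    by (rule homeomorphic_space_wedge_reindex[OF f]) (simp_all add: card)
  also have "wedge (\<lambda>_. nsphere D) (\<lambda>_. pole) {..<card S} = wedge_of_spheres (card S) D"
    by (simp add: wedge_of_spheres_def pole_def[abs_def])
  finally show ?thesis
    using homotopy_equivalent_wedge_of_cells
    by (metis homeomorphic_imp_homotopy_equivalent_space homotopy_eqv_trans)
qed


section \<open>Total 2-cut complexes of triangle-free graphs\<close>

definition simple_graph :: "'a ugraph \<Rightarrow> bool" where
  "simple_graph G \<longleftrightarrow> (\<forall>e\<in>edges G. e \<subseteq> verts G \<and> card e = 2)"

definition adjacent :: "'a ugraph \<Rightarrow> 'a \<Rightarrow> 'a \<Rightarrow> bool" where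
  "adjacent G u v \<longleftrightarrow> {u, v} \<in> edges G"

definition connected_graph :: "'a ugraph \<Rightarrow> bool" where
  "connected_graph G \<longleftrightarrow> (\<forall>u\<in>verts G. \<forall>v\<in>verts G. (adjacent G)\<^sup>*\<^sup>* u v)"

definition triangle_free :: "'a ugraph \<Rightarrow> bool" where
  "triangle_free G \<longleftrightarrow> (\<forall>u v w. adjacent G u v \<longrightarrow> adjacent G v w \<longrightarrow> \<not> adjacent G u w)"

lemma adjacent_commute: "adjacent G u v \<longleftrightarrow> adjacent G v u"
  by (simp add: adjacent_def insert_commute)

lemma simple_graph_adjacentD:
  assumes "simple_graph G" "adjacent G u v"
  shows "u \<in> verts G" "v \<in> verts G" "u \<noteq> v"
  using assms by (auto simp: simple_graph_def adjacent_def)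

lemma simple_graph_edgeE:
  assumes "simple_graph G" "e \<in> edges G"
  obtains u v where "e = {u, v}" "u \<noteq> v" "u \<in> verts G" "v \<in> verts G" "adjacent G u v"
proof -
  from assms have "card e = 2" "e \<subseteq> verts G"
    by (auto simp: simple_graph_def)
  then obtain u v where "e = {u, v}" "u \<noteq> v"
    by (auto simp: card_2_iff)
  with assms(2) \<open>e \<subseteq> verts G\<close> show thesis
    by (intro that) (auto simp: adjacent_def)
qed

lemma simple_graph_finite_edges:
  assumes "simple_graph G" "finite (verts G)"
  shows "finite (edges G)"
proof (rule finite_subset)
  show "edges G \<subseteq> Pow (verts G)"
    using assms(1) by (auto simp: simple_graph_def)
qed (simp add: assms(2))

lemma clique_edge: "adjacent G u v \<Longrightarrow> clique {u, v} (edges G)"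
  by (auto simp: clique_def adjacent_def insert_commute)

lemma in_total_2_cut_complex_iff:
  "\<sigma> \<in> total_2_cut_complex G \<longleftrightarrow> \<sigma> \<subseteq> verts G \<and> \<not> clique (verts G - \<sigma>) (edges G)"
proof -
  have "\<sigma> \<in> total_2_cut_complex G \<longleftrightarrow>
      (\<exists>a b. a \<in> verts G \<and> b \<in> verts G \<and> a \<noteq> b \<and> {a, b} \<notin> edges G \<and> \<sigma> \<subseteq> verts G - {a, b})"
    unfolding total_2_cut_complex_def complex_generated_by_def mem_Collect_eq Bex_def by metis
  then show ?thesis
    unfolding clique_def subset_Diff_insert by auto
qed

lemma finite_simplicial_complex_total_2_cut_complex:
  assumes "finite (verts G)"
  shows "finite_simplicial_complex (verts G) (total_2_cut_complex G)"
proof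
  fix \<sigma> \<tau> assume "\<tau> \<in> total_2_cut_complex G" "\<sigma> \<subseteq> \<tau>"
  then show "\<sigma> \<in> total_2_cut_complex G"
    unfolding in_total_2_cut_complex_iff by (meson Diff_mono order_refl order_trans smaller_clique)
qed (use assms in \<open>auto simp: in_total_2_cut_complex_iff\<close>)

lemma complex_dim_total_2_cut_complex:
  assumes fin: "finite (verts G)" and not_clique: "\<not> clique (verts G) (edges G)"
  shows "complex_dim (total_2_cut_complex G) = int (card (verts G)) - 3"
proof -
  interpret finite_simplicial_complex "verts G" "total_2_cut_complex G"
    by (rule finite_simplicial_complex_total_2_cut_complex[OF fin])
  have card_facet: "card (verts G - {c, d}) = card (verts G) - 2"
    if "c \<in> verts G" "d \<in> verts G" "c \<noteq> d" for c d
    using that by (simp add: card_Diff_subset)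
  obtain a b where ab: "a \<in> verts G" "b \<in> verts G" "a \<noteq> b" "{a, b} \<notin> edges G"
    using not_clique by (auto simp: clique_def)
  have "Max (card ` total_2_cut_complex G) = card (verts G) - 2"
  proof (rule Max_eqI)
    show "finite (card ` total_2_cut_complex G)"
      using finite_complex by simp
    have "verts G - {a, b} \<in> total_2_cut_complex G"
      using ab by (auto simp: in_total_2_cut_complex_iff clique_def)
    then show "card (verts G) - 2 \<in> card ` total_2_cut_complex G"
      using card_facet[OF ab(1-3)] by (metis image_eqI)
    fix k assume "k \<in> card ` total_2_cut_complex G"
    then obtain \<sigma> c d where "k = card \<sigma>" "\<sigma> \<subseteq> verts G - {c, d}"
      and cd: "c \<in> verts G" "d \<in> verts G" "c \<noteq> d"
      by (fastforce simp: in_total_2_cut_complex_iff clique_def)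
    then show "k \<le> card (verts G) - 2"
      using fin card_mono[of "verts G - {c, d}" \<sigma>] card_facet[OF cd] by simp
  qed
  moreover have "2 \<le> card (verts G)"
    using card_mono[OF fin, of "{a, b}"] ab by simp
  ultimately show ?thesis
    by (simp add: complex_dim_def)
qed

lemma triangle_free_card_clique_le:
  assumes "triangle_free G" "finite C" "clique C (edges G)"
  shows "card C \<le> 2"
proof (rule ccontr)
  assume "\<not> card C \<le> 2"
  then have "3 \<le> card C" by simp
  then obtain B where "B \<subseteq> C" "card B = 3"
    by (meson obtain_subset_with_card_n)
  then obtain u v w where "{u, v, w} \<subseteq> C" "u \<noteq> v" "v \<noteq> w" "u \<noteq> w"
    by (auto simp: card_3_iff)
  with assms(3) have "adjacent G u v" "adjacent G v w" "adjacent G u w"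
    by (simp_all add: clique_def adjacent_def)
  with assms(1) show False
    unfolding triangle_free_def by blast
qed

text \<open>\<open>parent\<close> describes a spanning tree, rooted at \<open>p\<close>, that contains all the edges at \<open>p\<close>.\<close>

locale rooted_triangle_free_graph =
  fixes G :: "'a ugraph" and p :: 'a and parent :: "'a \<Rightarrow> 'a" and depth :: "'a \<Rightarrow> nat"
  assumes finite_verts: "finite (verts G)"
    and simple: "simple_graph G"
    and triangle_free: "triangle_free G"
    and card_verts: "4 \<le> card (verts G)"
    and root: "p \<in> verts G"
    and adjacent_parent: "v \<in> verts G - {p} \<Longrightarrow> adjacent G v (parent v)"
    and depth_parent: "v \<in> verts G - {p} \<Longrightarrow> depth (parent v) < depth v"
    and parent_neighbour: "adjacent G p v \<Longrightarrow> parent v = p"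
begin

abbreviation V :: "'a set" where
  "V \<equiv> verts G"

abbreviation cut_complex :: "'a set set" where
  "cut_complex \<equiv> total_2_cut_complex G"

sublocale finite_simplicial_complex V cut_complex
  by (rule finite_simplicial_complex_total_2_cut_complex[OF finite_verts])

definition star :: "'a set set" where
  "star = {\<sigma> \<in> cut_complex. insert p \<sigma> \<in> cut_complex}"

definition far :: "'a set" where
  "far = {v \<in> V - {p}. \<not> adjacent G p v}"

definition tree_edges :: "'a set set" where
  "tree_edges = (\<lambda>v. {v, parent v}) ` (V - {p})"

definition complement_face :: "'a set \<Rightarrow> 'a set" where
  "complement_face C = V - insert p C"

definition cells :: "'a set set" where
  "cells = complement_face ` (edges G - tree_edges)"

definition matched :: "'a \<Rightarrow> 'a set set" where
  "matched v = {complement_face {v, parent v}, complement_face {v}}"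

lemma Diff_in_cut_complex_iff: "C \<subseteq> V \<Longrightarrow> V - C \<in> cut_complex \<longleftrightarrow> \<not> clique C (edges G)"
  by (simp add: in_total_2_cut_complex_iff double_diff)

lemma farD:
  assumes "v \<in> far"
  shows "v \<in> V" "v \<noteq> p" "\<not> adjacent G p v" "parent v \<in> V" "parent v \<noteq> p" "parent v \<noteq> v"
    "adjacent G v (parent v)" "depth (parent v) < depth v"
proof -
  show v: "v \<in> V" "v \<noteq> p" "\<not> adjacent G p v"
    using assms by (auto simp: far_def)
  then show edge: "adjacent G v (parent v)" and "depth (parent v) < depth v"
    using adjacent_parent depth_parent by auto
  show "parent v \<in> V" "parent v \<noteq> v"
    using simple_graph_adjacentD[OF simple edge] by auto
  show "parent v \<noteq> p"
    using edge v(3) adjacent_commute by metis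
qed

lemma inj_on_tree_edge: "inj_on (\<lambda>v. {v, parent v}) (V - {p})"
proof (rule inj_onI)
  fix u v assume u: "u \<in> V - {p}" and v: "v \<in> V - {p}" and eq: "{u, parent u} = {v, parent v}"
  show "u = v"
  proof (rule ccontr)
    assume "u \<noteq> v"
    with eq have "parent u = v" "parent v = u"
      unfolding doubleton_eq_iff by blast+
    with depth_parent[OF u] depth_parent[OF v] show False by simp
  qed
qed

lemma card_nontree_edges: "card (edges G - tree_edges) = card (edges G) + 1 - card V"
proof -
  have "tree_edges \<subseteq> edges G"
    using adjacent_parent by (auto simp: tree_edges_def adjacent_def)
  then have "card (edges G - tree_edges) = card (edges G) - card tree_edges"
    using simple_graph_finite_edges[OF simple finite_verts]
    by (intro card_Diff_subset) (auto intro: finite_subset)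
  moreover have "card tree_edges = card V - 1"
    using root by (simp add: tree_edges_def card_image inj_on_tree_edge)
  ultimately show ?thesis
    using card_verts by simp
qed

lemma edge_at_root_in_tree:
  assumes "e \<in> edges G" "p \<in> e"
  shows "e \<in> tree_edges"
proof -
  obtain u v where "e = {u, v}" "u \<noteq> v" "u \<in> V" "v \<in> V" "adjacent G u v"
    by (rule simple_graph_edgeE[OF simple assms(1)])
  with assms(2) obtain w where "e = {w, p}" "w \<in> V - {p}" "adjacent G p w"
    using adjacent_commute[of G u v] by (cases "u = p") (auto simp: insert_commute)
  with parent_neighbour show ?thesis
    by (auto simp: tree_edges_def)
qed

lemma tree_edge_avoiding_root:
  assumes "e \<in> tree_edges" "p \<notin> e"
  obtains v where "v \<in> far" "e = {v, parent v}"
  using assms parent_neighbour by (auto simp: tree_edges_def far_def)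

lemma nontree_edgeE:
  assumes "e \<in> edges G - tree_edges"
  obtains u v where "e = {u, v}" "u \<noteq> v" "u \<in> V - {p}" "v \<in> V - {p}" "adjacent G u v"
  using simple_graph_edgeE[OF simple, of e] edge_at_root_in_tree[of e] assms by blast

lemma large_cut_not_clique:
  assumes "C \<subseteq> V" "3 \<le> card C"
  shows "V - C \<in> cut_complex"
  using assms triangle_free_card_clique_le[OF triangle_free, of C] finite_subset[OF _ finite_verts, of C]
  by (auto simp: Diff_in_cut_complex_iff)

lemma inj_on_complement_face: "inj_on complement_face (Pow (V - {p}))"
proof (rule inj_on_inverseI)
  show "V - insert p (complement_face C) = C" if "C \<in> Pow (V - {p})" for C
    using that by (auto simp: complement_face_def)
qed

lemma complement_face_in_star_iff:
  assumes "C \<subseteq> V - {p}"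
  shows "complement_face C \<in> star \<longleftrightarrow> \<not> clique C (edges G)"
proof -
  have "insert p (complement_face C) = V - C"
    using assms root by (auto simp: complement_face_def)
  then have "insert p (complement_face C) \<in> cut_complex \<longleftrightarrow> \<not> clique C (edges G)"
    using assms by (simp add: Diff_in_cut_complex_iff subset_Diff_insert)
  moreover have "insert p (complement_face C) \<in> cut_complex \<Longrightarrow> complement_face C \<in> cut_complex"
    by (erule face_closed) blast
  ultimately show ?thesis
    by (auto simp: star_def)
qed

lemma face_outside_star:
  assumes \<sigma>: "\<sigma> \<in> cut_complex - star"
  shows "(\<exists>v\<in>far. \<sigma> = complement_face {v}) \<or> (\<exists>e\<in>edges G. p \<notin> e \<and> \<sigma> = complement_face e)"
proof -
  define C where "C = V - insert p \<sigma>"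
  have "\<sigma> \<subseteq> V" and not_clique: "\<not> clique (V - \<sigma>) (edges G)"
    using \<sigma> by (auto simp: in_total_2_cut_complex_iff)
  have C: "C \<subseteq> V - {p}" "finite C"
    using finite_verts by (auto simp: C_def)
  have clique: "clique C (edges G)"
    using \<sigma> \<open>\<sigma> \<subseteq> V\<close> root by (auto simp: star_def in_total_2_cut_complex_iff C_def)
  have "p \<notin> \<sigma>"
    using not_clique clique by (auto simp: C_def insert_absorb)
  then have \<sigma>_eq: "\<sigma> = complement_face C" and "V - \<sigma> = insert p C"
    using \<open>\<sigma> \<subseteq> V\<close> root by (auto simp: complement_face_def C_def)
  with not_clique clique obtain v where v: "v \<in> C" "\<not> adjacent G p v"
    by (auto simp: clique_def adjacent_def insert_commute)
  then have "v \<in> far"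
    using C by (auto simp: far_def)
  have "card C \<le> 2"
    by (rule triangle_free_card_clique_le[OF triangle_free C(2) clique])
  moreover have "card C \<noteq> 0"
    using v(1) C(2) by auto
  ultimately consider (vertex) "card C = 1" | (edge) "card C = 2" by linarith
  then show ?thesis
  proof cases
    case vertex
    with v(1) have "C = {v}"
      by (auto simp: card_1_singleton_iff)
    with \<sigma>_eq \<open>v \<in> far\<close> show ?thesis by blast
  next
    case edge
    then have "C \<in> edges G"
      using clique by (auto simp: card_2_iff clique_def)
    with \<sigma>_eq C(1) show ?thesis by blast
  qed
qed

lemma matched_not_in_star:
  assumes "v \<in> far" and "\<sigma> \<in> matched v"
  shows "\<sigma> \<notin> star"
proof -
  have "clique {v} (edges G)" "clique {v, parent v} (edges G)"
    using clique_edge[OF farD(7)[OF assms(1)]] by (simp_all add: clique_def)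
  then have "complement_face {v} \<notin> star" "complement_face {v, parent v} \<notin> star"
    using farD[OF assms(1)] by (simp_all add: complement_face_in_star_iff)
  with assms(2) show ?thesis
    by (auto simp: matched_def)
qed

lemma cell_not_matched:
  assumes "v \<in> far" and "R \<in> cells"
  shows "R \<notin> matched v"
proof -
  obtain e where e: "e \<in> edges G - tree_edges" "R = complement_face e"
    using assms(2) by (auto simp: cells_def)
  obtain a b where "e = {a, b}" "a \<noteq> b" "a \<in> V - {p}" "b \<in> V - {p}"
    by (rule nontree_edgeE[OF e(1)])
  then have "e \<noteq> {v}" "e \<in> Pow (V - {p})"
    by auto
  moreover have "{v, parent v} \<in> tree_edges"
    using farD[OF assms(1)] by (simp add: tree_edges_def)
  with e(1) have "e \<noteq> {v, parent v}" by blast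
  ultimately show ?thesis
    using farD[OF assms(1)] by (simp add: matched_def e(2) inj_on_eq_iff[OF inj_on_complement_face])
qed

lemma disjoint_matched: "disjoint_family_on matched far"
  unfolding disjoint_family_on_def
proof (intro ballI impI)
  fix u v assume u: "u \<in> far" and v: "v \<in> far" and "u \<noteq> v"
  have "{u, parent u} \<noteq> {v, parent v}"
    using inj_onD[OF inj_on_tree_edge, of u v] farD(1,2)[OF u] farD(1,2)[OF v] \<open>u \<noteq> v\<close> by blast
  then have "{{u, parent u}, {u}} \<inter> {{v, parent v}, {v}} = {}"
    using \<open>u \<noteq> v\<close> farD(6)[OF u] farD(6)[OF v] by auto
  moreover have "matched w = complement_face ` {{w, parent w}, {w}}" for w
    by (simp add: matched_def)
  ultimately show "matched u \<inter> matched v = {}"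
    using farD[OF u] farD[OF v] inj_on_image_Int[OF inj_on_complement_face,
        of "{{u, parent u}, {u}}" "{{v, parent v}, {v}}"] by simp
qed

lemma cells_subset_cut_complex: "cells \<subseteq> cut_complex"
proof
  fix R assume "R \<in> cells"
  then obtain e where e: "e \<in> edges G - tree_edges" "R = complement_face e"
    by (auto simp: cells_def)
  obtain a b where "e = {a, b}" "a \<noteq> b" "a \<in> V - {p}" "b \<in> V - {p}"
    by (rule nontree_edgeE[OF e(1)])
  with root show "R \<in> cut_complex"
    unfolding e(2) complement_face_def by (intro large_cut_not_clique) auto
qed

lemma cut_complex_minus_matched: "cut_complex - (\<Union>v\<in>far. matched v) = star \<union> cells"
proof
  show "star \<union> cells \<subseteq> cut_complex - (\<Union>v\<in>far. matched v)"
    using matched_not_in_star cell_not_matched cells_subset_cut_complex by (auto simp: star_def)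
  show "cut_complex - (\<Union>v\<in>far. matched v) \<subseteq> star \<union> cells"
  proof (intro subsetI, rule ccontr)
    fix \<sigma> assume \<sigma>: "\<sigma> \<in> cut_complex - (\<Union>v\<in>far. matched v)" and out: "\<sigma> \<notin> star \<union> cells"
    have "\<sigma> \<noteq> complement_face {v}" if "v \<in> far" for v
      using \<sigma> that by (auto simp: matched_def)
    with face_outside_star[of \<sigma>] \<sigma> out obtain e where e: "e \<in> edges G" "p \<notin> e" "\<sigma> = complement_face e"
      by blast
    with out have "e \<in> tree_edges"
      by (auto simp: cells_def)
    then obtain v where "v \<in> far" "e = {v, parent v}"
      using e(2) by (rule tree_edge_avoiding_root)
    with \<sigma> e(3) show False
      by (auto simp: matched_def)
  qed
qed

lemma coface_of_matched:
  assumes v: "v \<in> far" and \<rho>: "\<rho> \<in> cut_complex" "complement_face {v, parent v} \<subseteq> \<rho>"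
  shows "\<rho> \<in> matched v \<or> parent v \<in> far \<and> \<rho> = complement_face {parent v}"
proof -
  let ?w = "parent v"
  have "\<rho> \<subseteq> V" and not_clique: "\<not> clique (V - \<rho>) (edges G)"
    using \<rho>(1) by (auto simp: in_total_2_cut_complex_iff)
  then have \<rho>_eq: "\<rho> = V - (V - \<rho>)" and sub: "V - \<rho> \<subseteq> {p, v, ?w}"
    using \<rho>(2) by (auto simp: complement_face_def)
  have "clique {p} (edges G)"
    by (simp add: clique_def)
  then have "\<not> V - \<rho> \<subseteq> {p}"
    using not_clique smaller_clique by blast
  moreover have "\<not> V - \<rho> \<subseteq> {v, ?w}"
    using not_clique smaller_clique[OF clique_edge[OF farD(7)[OF v]]] by blast
  ultimately consider (face) "V - \<rho> = {p, v, ?w}" | (coface) "V - \<rho> = {p, v}"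
    | (parent) "V - \<rho> = {p, ?w}"
    using sub by blast
  then show ?thesis
  proof cases
    case parent
    then have "?w \<in> far"
      using not_clique clique_edge[of G p ?w] farD(4,5)[OF v] by (auto simp: far_def)
    with parent \<rho>_eq show ?thesis
      by (simp add: complement_face_def)
  qed (use \<rho>_eq in \<open>simp_all add: matched_def complement_face_def\<close>)
qed

lemma cut_complex_collapses: "elementary_collapse\<^sup>*\<^sup>* cut_complex (star \<union> cells)"
proof -
  have "elementary_collapse\<^sup>*\<^sup>* cut_complex
      (cut_complex - (\<Union>v\<in>far. {complement_face {v, parent v}, complement_face {v}}))"
  proof (rule elementary_collapses_acyclic_matching[where rank = depth])
    show "finite far"
      using finite_verts by (simp add: far_def)
    show "disjoint_family_on (\<lambda>v. {complement_face {v, parent v}, complement_face {v}}) far"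
      using disjoint_matched by (simp add: matched_def[abs_def])
    fix v assume v: "v \<in> far"
    have "\<not> clique {p, v} (edges G)"
      using farD[OF v] by (auto simp: clique_def adjacent_def)
    then have "complement_face {v} \<in> cut_complex"
      using farD(1)[OF v] root by (simp add: Diff_in_cut_complex_iff complement_face_def)
    moreover have "card {p, v, parent v} < card V"
      using card_verts by (simp add: card_insert_if)
    then have "complement_face {v, parent v} \<noteq> {}"
      using card_mono[of "{p, v, parent v}" V] by (auto simp: complement_face_def)
    moreover have "parent v \<notin> complement_face {v, parent v}"
      and "complement_face {v} = insert (parent v) (complement_face {v, parent v})"
      using farD[OF v] by (auto simp: complement_face_def)
    ultimately show "complement_face {v, parent v} \<noteq> {} \<and> complement_face {v} \<in> cut_complex \<and>
        (\<exists>a. a \<notin> complement_face {v, parent v} \<and>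
          complement_face {v} = insert a (complement_face {v, parent v}))"
      by blast
    fix \<rho> assume "\<rho> \<in> cut_complex" "complement_face {v, parent v} \<subseteq> \<rho>"
    then show "\<rho> \<in> {complement_face {v, parent v}, complement_face {v}} \<or>
        (\<exists>u\<in>far. depth u < depth v \<and> \<rho> \<in> {complement_face {u, parent u}, complement_face {u}})"
      using coface_of_matched[OF v] farD(8)[OF v] unfolding matched_def by blast
  qed
  then show ?thesis
    by (simp only: cut_complex_minus_matched flip: matched_def)
qed

lemma singleton_root_in_cut_complex: "{p} \<in> cut_complex"
proof -
  have "3 \<le> card (V - {p})"
    using card_verts root finite_verts by simp
  then have "V - (V - {p}) \<in> cut_complex"
    by (intro large_cut_not_clique) auto
  with root show ?thesis
    by (simp add: double_diff)
qed

lemma star_closed: "\<tau> \<in> star \<Longrightarrow> \<sigma> \<subseteq> \<tau> \<Longrightarrow> \<sigma> \<in> star"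
  using face_closed[of \<tau> \<sigma>] face_closed[of "insert p \<tau>" "insert p \<sigma>"] by (auto simp: star_def)

lemma star_cone_with_cells: "cone_with_cells V star p cells"
proof
  show "finite V"
    by (rule finite_verts)
  show "star \<subseteq> Pow V"
    using faces_subset by (auto simp: star_def)
  show "\<sigma> \<in> star" if "\<tau> \<in> star" "\<sigma> \<subseteq> \<tau>" for \<sigma> \<tau>
    using that by (rule star_closed)
  show "insert p \<sigma> \<in> star" if "\<sigma> \<in> star" for \<sigma>
    using that by (simp add: star_def)
  show "{} \<in> star"
    using singleton_root_in_cut_complex face_closed[of "{p}" "{}"] by (simp add: star_def)
  fix R assume "R \<in> cells"
  then obtain e where e: "e \<in> edges G - tree_edges" and R: "R = complement_face e"
    by (auto simp: cells_def)
  obtain a b where ab: "e = {a, b}" "a \<noteq> b" "a \<in> V - {p}" "b \<in> V - {p}" "adjacent G a b"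
    by (rule nontree_edgeE[OF e])
  show "R \<subseteq> V"
    by (auto simp: R complement_face_def)
  show "R \<notin> star"
    using ab clique_edge[of G a b] by (simp add: R complement_face_in_star_iff)
  fix \<sigma> assume "\<sigma> \<subset> R"
  then obtain c where c: "c \<in> V - {p, a, b}" "c \<notin> \<sigma>" and "\<sigma> \<subseteq> V - {p, a, b}"
    unfolding R ab(1) complement_face_def by blast
  then have "\<sigma> \<subseteq> complement_face {a, b, c}"
    by (auto simp: complement_face_def)
  moreover have "\<not> clique {a, b, c} (edges G)"
    using triangle_free_card_clique_le[OF triangle_free, of "{a, b, c}"] ab(2) c(1) by auto
  then have "complement_face {a, b, c} \<in> star"
    using ab c(1) by (simp add: complement_face_in_star_iff)
  ultimately show "\<sigma> \<in> star"
    using star_closed by blast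
qed

lemma card_cell:
  assumes "R \<in> cells"
  shows "card R = Suc (card V - 4)"
proof -
  obtain e where e: "e \<in> edges G - tree_edges" "R = complement_face e"
    using assms by (auto simp: cells_def)
  obtain a b where ab: "e = {a, b}" "a \<noteq> b" "a \<in> V - {p}" "b \<in> V - {p}"
    by (rule nontree_edgeE[OF e(1)])
  then have "card {p, a, b} = 3" by auto
  moreover have "card (V - {p, a, b}) = card V - card {p, a, b}"
    using ab root by (intro card_Diff_subset) auto
  ultimately show ?thesis
    using card_verts by (simp add: e(2) ab(1) complement_face_def)
qed

lemma card_cells: "card cells = card (edges G) + 1 - card V"
proof -
  have "edges G - tree_edges \<subseteq> Pow (V - {p})"
    by (auto elim!: nontree_edgeE)
  then have "inj_on complement_face (edges G - tree_edges)"
    by (rule inj_on_subset[OF inj_on_complement_face])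
  then show ?thesis
    by (simp add: cells_def card_image card_nontree_edges)
qed

lemma homotopy_equivalent_cut_complex:
  "geometric_realization cut_complex homotopy_equivalent_space
    wedge_of_spheres (card (edges G) + 1 - card V) (card V - 4)"
  using homotopy_equivalent_collapses[OF cut_complex_collapses]
    homotopy_equivalent_wedge_of_spheres[OF star_cone_with_cells card_cell]
  unfolding card_cells by (rule homotopy_eqv_trans)

end

lemma connected_graph_parent_exists:
  assumes "connected_graph G" "p \<in> verts G"
  obtains parent and depth :: "'a \<Rightarrow> nat" where
    "\<forall>v\<in>verts G - {p}. adjacent G v (parent v) \<and> depth (parent v) < depth v"
    "\<forall>v. adjacent G p v \<longrightarrow> parent v = p"
proof -
  define depth where "depth v = (LEAST k. (adjacent G ^^ k) p v)" for v
  have depth_le: "depth v \<le> k" if "(adjacent G ^^ k) p v" for v k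
    unfolding depth_def using that by (rule Least_le)
  have "depth p = 0"
    using depth_le[of 0 p] by simp
  have "\<exists>u. adjacent G v u \<and> depth u < depth v" if "v \<in> verts G - {p}" for v
  proof -
    have "(adjacent G)\<^sup>*\<^sup>* p v"
      using assms that by (simp add: connected_graph_def)
    then have path: "(adjacent G ^^ depth v) p v"
      unfolding depth_def using rtranclp_imp_relpowp LeastI_ex by metis
    with that obtain k where k: "depth v = Suc k"
      by (cases "depth v") auto
    with path obtain u where "(adjacent G ^^ k) p u" "adjacent G u v"
      by auto
    with k depth_le show ?thesis
      using adjacent_commute le_imp_less_Suc by metis
  qed
  then obtain parent where parent:
    "\<And>v. v \<in> verts G - {p} \<Longrightarrow> adjacent G v (parent v) \<and> depth (parent v) < depth v"
    by metis
  define parent' where "parent' v = (if adjacent G p v then p else parent v)" for v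
  show thesis
  proof (rule that[of parent' depth])
    show "\<forall>v\<in>verts G - {p}. adjacent G v (parent' v) \<and> depth (parent' v) < depth v"
    proof
      fix v assume "v \<in> verts G - {p}"
      from parent[OF this] \<open>depth p = 0\<close> show "adjacent G v (parent' v) \<and> depth (parent' v) < depth v"
        using adjacent_commute[of G v p] by (auto simp: parent'_def)
    qed
  qed (simp add: parent'_def)
qed

theorem homotopy_equivalent_total_2_cut_complex_triangle_free:
  assumes "finite (verts G)" "simple_graph G" "connected_graph G" "triangle_free G" "4 \<le> card (verts G)"
  shows "geometric_realization (total_2_cut_complex G) homotopy_equivalent_space
    wedge_of_spheres (card (edges G) + 1 - card (verts G)) (card (verts G) - 4)"
proof -
  from assms(5) have "verts G \<noteq> {}" by auto
  then obtain p where p: "p \<in> verts G" by blast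
  obtain parent and depth :: "'a \<Rightarrow> nat" where
    "\<forall>v\<in>verts G - {p}. adjacent G v (parent v) \<and> depth (parent v) < depth v"
    "\<forall>v. adjacent G p v \<longrightarrow> parent v = p"
    by (rule connected_graph_parent_exists[OF assms(3) p])
  with assms p interpret rooted_triangle_free_graph G p parent depth
    by unfold_locales auto
  show ?thesis
    by (rule homotopy_equivalent_cut_complex)
qed


section \<open>Grid graphs\<close>

lemma verts_cartesian_product: "verts (cartesian_product G H) = verts G \<times> verts H"
  by (simp add: cartesian_product_def)

lemma adjacent_cartesian_product_iff:
  "adjacent (cartesian_product G H) x y \<longleftrightarrow>
     adjacent G (fst x) (fst y) \<and> snd x = snd y \<and> snd y \<in> verts H \<or>
     fst x = fst y \<and> fst y \<in> verts G \<and> adjacent H (snd x) (snd y)"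
proof -
  have "{(u, w), (u', w')} \<in> {{(u, w), (u', w)} | u u' w. {u, u'} \<in> E \<and> w \<in> W} \<longleftrightarrow>
      {u, u'} \<in> E \<and> w = w' \<and> w' \<in> W" for u u' w w' and E :: "'a set set" and W :: "'b set"
    by (fastforce simp: doubleton_eq_iff insert_commute)
  moreover have "{(u, w), (u', w')} \<in> {{(u, w), (u, w')} | u w w'. u \<in> U \<and> {w, w'} \<in> E} \<longleftrightarrow>
      u = u' \<and> u' \<in> U \<and> {w, w'} \<in> E" for u u' w w' and E :: "'b set set" and U :: "'a set"
    by (fastforce simp: doubleton_eq_iff insert_commute)
  ultimately have "adjacent (cartesian_product G H) (u, w) (u', w') \<longleftrightarrow>
      adjacent G u u' \<and> w = w' \<and> w' \<in> verts H \<or> u = u' \<and> u' \<in> verts G \<and> adjacent H w w'" for u w u' w'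
    by (simp add: cartesian_product_def adjacent_def)
  then show ?thesis by (cases x; cases y) simp
qed

lemma edges_cartesian_product:
  assumes "simple_graph G" "simple_graph H"
  shows "edges (cartesian_product G H) =
    (\<lambda>(e, w). e \<times> {w}) ` (edges G \<times> verts H) \<union> (\<lambda>(u, e). {u} \<times> e) ` (verts G \<times> edges H)"
    (is "_ = ?E")
proof (rule set_eqI)
  fix x
  have doubleton: "(\<exists>u v. {u, v} \<in> edges F \<and> P {u, v}) \<longleftrightarrow> (\<exists>e\<in>edges F. P e)"
    if "simple_graph F" for F :: "'c ugraph" and P
    using simple_graph_edgeE[OF that] by metis
  have "x \<in> edges (cartesian_product G H) \<longleftrightarrow>
      (\<exists>u u'. {u, u'} \<in> edges G \<and> (\<exists>w\<in>verts H. x = {u, u'} \<times> {w})) \<or>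
      (\<exists>w w'. {w, w'} \<in> edges H \<and> (\<exists>u\<in>verts G. x = {u} \<times> {w, w'}))"
    by (simp add: cartesian_product_def) blast
  also have "\<dots> \<longleftrightarrow> (\<exists>e\<in>edges G. \<exists>w\<in>verts H. x = e \<times> {w}) \<or> (\<exists>e\<in>edges H. \<exists>u\<in>verts G. x = {u} \<times> e)"
    by (simp only: doubleton[OF assms(1), of "\<lambda>e. \<exists>w\<in>verts H. x = e \<times> {w}"]
        doubleton[OF assms(2), of "\<lambda>e. \<exists>u\<in>verts G. x = {u} \<times> e"])
  also have "\<dots> \<longleftrightarrow> x \<in> ?E"
    by auto
  finally show "x \<in> edges (cartesian_product G H) \<longleftrightarrow> x \<in> ?E" .
qed

lemma simple_graph_cartesian_product:
  assumes "simple_graph G" "simple_graph H"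
  shows "simple_graph (cartesian_product G H)"
  using assms by (fastforce simp: simple_graph_def verts_cartesian_product
      edges_cartesian_product[OF assms] card_cartesian_product)

lemma card_edges_cartesian_product:
  assumes fin: "finite (verts G)" "finite (verts H)" and simple: "simple_graph G" "simple_graph H"
  shows "card (edges (cartesian_product G H)) =
    card (edges G) * card (verts H) + card (verts G) * card (edges H)"
proof -
  have nonempty: "e \<noteq> {}" if "e \<in> edges F" "simple_graph F" for e and F :: "'c ugraph"
    using that by (auto simp: simple_graph_def)
  let ?A = "(\<lambda>(e, w). e \<times> {w}) ` (edges G \<times> verts H)"
  let ?B = "(\<lambda>(u, e). {u} \<times> e) ` (verts G \<times> edges H)"
  have "card (?A \<union> ?B) = card ?A + card ?B"
  proof (rule card_Un_disjoint)
    show "?A \<inter> ?B = {}"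
    proof (rule equals0I)
      fix x assume "x \<in> ?A \<inter> ?B"
      then have "card (fst ` x) = 2" "card (fst ` x) = 1"
        using simple(1) nonempty[OF _ simple(2)] by (auto simp: simple_graph_def)
      then show False by simp
    qed
  qed (use fin simple_graph_finite_edges[OF simple(1)] simple_graph_finite_edges[OF simple(2)] in auto)
  moreover have "inj_on (\<lambda>(e, w). e \<times> {w}) (edges G \<times> verts H)"
    using nonempty[OF _ simple(1)] by (auto simp: inj_on_def times_eq_iff)
  moreover have "inj_on (\<lambda>(u, e). {u} \<times> e) (verts G \<times> edges H)"
    using nonempty[OF _ simple(2)] by (auto simp: inj_on_def times_eq_iff)
  ultimately show ?thesis
    by (simp add: edges_cartesian_product[OF simple] card_image card_cartesian_product)
qed

text \<open>Consecutive edges in different directions change both coordinates, so that a triangle would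
  lie in a single copy of one of the factors.\<close>

lemma triangle_free_cartesian_product:
  assumes "simple_graph G" "simple_graph H" and "triangle_free G" "triangle_free H"
  shows "triangle_free (cartesian_product G H)"
proof -
  have "\<not> adjacent G u u" "\<not> adjacent H w w" for u w
    using simple_graph_adjacentD(3)[OF assms(1), of u u] simple_graph_adjacentD(3)[OF assms(2), of w w]
    by auto
  with assms(3,4) show ?thesis
    unfolding triangle_free_def adjacent_cartesian_product_iff by metis
qed

lemma connected_graph_cartesian_product:
  assumes "connected_graph G" "connected_graph H"
  shows "connected_graph (cartesian_product G H)"
proof -
  let ?P = "cartesian_product G H"
  have horizontal: "(adjacent ?P)\<^sup>*\<^sup>* (u, w) (u', w)" if "(adjacent G)\<^sup>*\<^sup>* u u'" "w \<in> verts H" for u u' w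
    using that(1)
  proof (induction rule: rtranclp_induct)
    case (step y z)
    with that(2) have "adjacent ?P (y, w) (z, w)"
      by (simp add: adjacent_cartesian_product_iff)
    with step.IH show ?case by (rule rtranclp.rtrancl_into_rtrancl)
  qed simp
  have vertical: "(adjacent ?P)\<^sup>*\<^sup>* (u, w) (u, w')" if "(adjacent H)\<^sup>*\<^sup>* w w'" "u \<in> verts G" for u w w'
    using that(1)
  proof (induction rule: rtranclp_induct)
    case (step y z)
    with that(2) have "adjacent ?P (u, y) (u, z)"
      by (simp add: adjacent_cartesian_product_iff)
    with step.IH show ?case by (rule rtranclp.rtrancl_into_rtrancl)
  qed simp
  show ?thesis
    unfolding connected_graph_def verts_cartesian_product
  proof (intro ballI)
    fix x y assume "x \<in> verts G \<times> verts H" "y \<in> verts G \<times> verts H"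
    moreover obtain u w u' w' where "x = (u, w)" "y = (u', w')"
      by (cases x; cases y)
    ultimately have "(adjacent ?P)\<^sup>*\<^sup>* x (u', w)" "(adjacent ?P)\<^sup>*\<^sup>* (u', w) y"
      using assms horizontal vertical by (simp_all add: connected_graph_def)
    then show "(adjacent ?P)\<^sup>*\<^sup>* x y"
      by (rule rtranclp_trans)
  qed
qed

lemma verts_path_graph: "verts (path_graph n) = {..<n}"
  by (simp add: path_graph_def)

lemma adjacent_path_graph_iff:
  "adjacent (path_graph n) i j \<longleftrightarrow> i < n \<and> j < n \<and> (j = Suc i \<or> i = Suc j)"
  by (auto simp: adjacent_def path_graph_def doubleton_eq_iff)

lemma simple_graph_path_graph: "simple_graph (path_graph n)"
  by (auto simp: simple_graph_def path_graph_def)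

lemma triangle_free_path_graph: "triangle_free (path_graph n)"
  by (auto simp: triangle_free_def adjacent_path_graph_iff)

lemma connected_graph_path_graph: "connected_graph (path_graph n)"
proof -
  have from_0: "(adjacent (path_graph n))\<^sup>*\<^sup>* 0 i" if "i < n" for i
    using that
  proof (induction i)
    case (Suc i)
    then have "(adjacent (path_graph n))\<^sup>*\<^sup>* 0 i" by simp
    moreover have "adjacent (path_graph n) i (Suc i)"
      using Suc.prems by (simp add: adjacent_path_graph_iff)
    ultimately show ?case by (rule rtranclp.rtrancl_into_rtrancl)
  qed simp
  have "symp (adjacent (path_graph n))"
    by (simp add: symp_def adjacent_commute)
  then have "(adjacent (path_graph n))\<^sup>*\<^sup>* i 0" if "i < n" for i
    using from_0[OF that] by (blast dest: sympD[OF symp_rtranclp])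
  with from_0 show ?thesis
    unfolding connected_graph_def verts_path_graph by (blast intro: rtranclp_trans)
qed

lemma card_edges_path_graph: "card (edges (path_graph n)) = n - 1"
proof -
  have "edges (path_graph n) = (\<lambda>i. {i, Suc i}) ` {..<n - 1}"
    by (auto simp: path_graph_def)
  moreover have "inj_on (\<lambda>i. {i, Suc i}) {..<n - 1}"
    by (auto simp: inj_on_def doubleton_eq_iff)
  ultimately show ?thesis
    by (simp add: card_image)
qed

lemma verts_grid_graph: "verts (grid_graph m n) = {..<m} \<times> {..<n}"
  by (simp add: grid_graph_def verts_cartesian_product verts_path_graph)

lemma simple_graph_grid_graph: "simple_graph (grid_graph m n)"
  by (simp add: grid_graph_def simple_graph_cartesian_product simple_graph_path_graph)

lemma triangle_free_grid_graph: "triangle_free (grid_graph m n)"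
  by (simp add: grid_graph_def triangle_free_cartesian_product simple_graph_path_graph
      triangle_free_path_graph)

lemma connected_graph_grid_graph: "connected_graph (grid_graph m n)"
  by (simp add: grid_graph_def connected_graph_cartesian_product connected_graph_path_graph)

lemma card_edges_grid_graph: "card (edges (grid_graph m n)) = (m - 1) * n + m * (n - 1)"
  by (simp add: grid_graph_def card_edges_cartesian_product simple_graph_path_graph verts_path_graph
      card_edges_path_graph)

theorem theorem4p16:
  fixes m n :: nat
  assumes "m \<ge> 2" and "n \<ge> 2"
  shows "complex_dim (total_2_cut_complex (grid_graph m n)) = int (m * n) - 3 \<and>
    geometric_realization (total_2_cut_complex (grid_graph m n))
      homotopy_equivalent_space wedge_of_spheres ((m - 1) * (n - 1)) (m * n - 4)"
proof
  have finite: "finite (verts (grid_graph m n))" and card: "card (verts (grid_graph m n)) = m * n"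
    by (simp_all add: verts_grid_graph card_cartesian_product)
  have large: "4 \<le> card (verts (grid_graph m n))"
    unfolding card using mult_le_mono[OF assms] by simp
  then have "\<not> clique (verts (grid_graph m n)) (edges (grid_graph m n))"
    using triangle_free_card_clique_le[OF triangle_free_grid_graph finite] by fastforce
  then show "complex_dim (total_2_cut_complex (grid_graph m n)) = int (m * n) - 3"
    by (simp add: complex_dim_total_2_cut_complex[OF finite] card)
  obtain k l where "m = Suc k" "n = Suc l"
    using assms by (auto dest!: Suc_le_D simp: numeral_2_eq_2)
  then have "card (edges (grid_graph m n)) + 1 - card (verts (grid_graph m n)) = (m - 1) * (n - 1)"
    unfolding card card_edges_grid_graph by simp
  then show "geometric_realization (total_2_cut_complex (grid_graph m n))
      homotopy_equivalent_space wedge_of_spheres ((m - 1) * (n - 1)) (m * n - 4)"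
    using homotopy_equivalent_total_2_cut_complex_triangle_free[OF finite simple_graph_grid_graph
        connected_graph_grid_graph triangle_free_grid_graph large] by (simp only: card)
qed

end
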